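(* Let $0\le k<m$, $0\le r\le k+1$ and $h\ge 1$ be integers. Let $\mathcal{C}\subseteq\mathbb{Z}_{2^h}^{2^m}$ be a coset of the linear code $\mathcal{A}(k,r,m,h)$ that contains a word in $\mathcal{R}(k,m,h)$. Then: (i) the polyphase version of every word in $\mathcal{C}$ has PMEPR at most $2^{k+1}$; (ii) the minimum Lee distance of $\mathcal{C}$ is equal to $2^{m-r}$, and the minimum squared Euclidean distance of $\mathcal{C}$ is equal to $2^{m-r+2}\sin^2\left(\frac{\pi}{2^h}\right)$; (iii) the number of encoded bits per codeword is $\log_2|\mathcal{C}|=\log_2|\mathcal{A}(k,r,m,h)|=s$, where $$s=(m-k)\cdot\log_2\big|\mathcal{F}(r-1,k,h)\big|+\log_2\big|\mathcal{F}(r,k,h)\big|,$$ with $$\log_2\big|\mathcal{F}(\rho,k,h)\big|=\sum_{i=0}^{\rho}h\binom{k}{i}+\sum_{i=1}^{h-1}(h-i)\binom{k}{\rho+i}\qquad(\rho\in\{r-1,r\}).$$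
   Context: A generalized Boolean function is a map $f:\{0,1\}^m\to\mathbb{Z}_{2^h}$ in variables $x_0,\dots,x_{m-1}$; it is uniquely a polynomial $\sum_{i\in\{0,1\}^m}c_i\prod_\alpha x_\alpha^{i_\alpha}$, $c_i\in\mathbb{Z}_{2^h}$ (algebraic normal form), and $\deg$ denotes the algebraic degree of this form, with the convention $\deg(0)=-\infty$. The word associated with $f$ is $\psi(f)=(f_0,\dots,f_{2^m-1})\in\mathbb{Z}_{2^h}^{2^m}$, where $f_i=f(i_0,\dots,i_{m-1})$ and $i=\sum_\alpha i_\alpha2^\alpha$, $i_\alpha\in\{0,1\}$. The effective degree of $f$ is $\max_{0\le i<h}[\deg(f\bmod 2^{i+1})-i]$, where $f\bmod 2^{i+1}$ is obtained by reducing the coefficients modulo $2^{i+1}$. $\mathcal{F}(\rho,m,h)$ is the set of all generalized Boolean functions $\{0,1\}^m\to\mathbb{Z}_{2^h}$ of effective degree at most $\rho$ ($\rho=-1$ is allowed). Empty sums are zero and $\binom{k}{j}=0$ for $j>k$. $\mathcal{A}(k,r,m,h)$ is the set of words associated with the functions $$\sum_{i=0}^{m-k-1}x_i\,g_i(x_{m-k},\dots,x_{m-1})+g(x_{m-k},\dots,x_{m-1}),$$ where $g_0,\dots,g_{m-k-1}\in\mathcal{F}(r-1,k,h)$ and $g\in\mathcal{F}(r,k,h)$. It is a linear code (submodule) over $\mathbb{Z}_{2^h}$; a coset of it is a set $\{\boldsymbol{a}+\boldsymbol{c}\mid\boldsymbol{c}\in\mathcal{A}(k,r,m,h)\}$ with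 $\boldsymbol{a}\in\mathbb{Z}_{2^h}^{2^m}$. $\mathcal{R}(k,m,h)$ is the set of words associated with the functions $$2^{h-1}\sum_{\boldsymbol{d}\in\{0,1\}^k}\ \sum_{i=0}^{m-k-2}x_{\pi_{\boldsymbol{d}}(i)}x_{\pi_{\boldsymbol{d}}(i+1)}\prod_{j=0}^{k-1}x_{m-k+j}^{d_j}(1-x_{m-k+j})^{1-d_j},$$ where $\boldsymbol{d}=(d_0,\dots,d_{k-1})$ and $\pi_{\boldsymbol{d}}$ ($\boldsymbol{d}\in\{0,1\}^k$) are arbitrary $2^k$ permutations of $\{0,1,\dots,m-k-1\}$ (with $0^0=1$). Let $\xi=e^{2\pi\sqrt{-1}/2^h}$. The polyphase version of $\boldsymbol{c}=(c_0,\dots,c_{n-1})\in\mathbb{Z}_{2^h}^n$ is $\boldsymbol{C}=(\xi^{c_0},\dots,\xi^{c_{n-1}})$. Its PMEPR is $\frac1n\sup_{0\le\theta<1}\left|\sum_{i=0}^{n-1}C_ie^{2\pi\sqrt{-1}(i+\zeta)\theta}\right|^2$, with $\zeta$ a fixed positive constant. For $\boldsymbol{a}\in\mathbb{Z}_{2^h}^n$ with entries represented in $\{0,\dots,2^h-1\}$, the Lee weight is $\mathrm{wt}_L(\boldsymbol{a})=\sum_i\min\{a_i,2^h-a_i\}$ and the squared Euclidean weight is $\mathrm{wt}_E^2(\boldsymbol{a})=\sum_i|\xi^{a_i}-1|^2$. The Lee and squared Euclidean distances between $\boldsymbol{a}$ and $\boldsymbol{b}$ are $\mathrm{wt}_L(\boldsymbol{a}-\boldsymbol{b})$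 and $\mathrm{wt}_E^2(\boldsymbol{a}-\boldsymbol{b})$; the minimum distances of a code are taken over all pairs of distinct codewords. *)

theory Defs
  imports "HOL-Analysis.Analysis" "HOL-Combinatorics.Permutations"
begin

text \<open>
  The ring of integers modulo \<open>2 ^ h\<close> is represented by the residues \<open>0, \<dots>, 2 ^ h - 1\<close>, with
  arithmetic on \<open>int\<close> followed by reduction. Functions with a finite domain are extensional, so that
  equality and cardinality of sets of functions and words are the intended ones.
\<close>

abbreviation Zpow2 :: "nat \<Rightarrow> int set" where
  "Zpow2 h \<equiv> {0..<2 ^ h}"

definition cube :: "nat \<Rightarrow> (nat \<Rightarrow> nat) set" where
  "cube m = {..<m} \<rightarrow>\<^sub>E {0, 1}"

definition gen_boolean_functions :: "nat \<Rightarrow> nat \<Rightarrow> ((nat \<Rightarrow> nat) \<Rightarrow> int) set" where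
  "gen_boolean_functions m h = cube m \<rightarrow>\<^sub>E Zpow2 h"


subsection \<open>Algebraic normal form and effective degree\<close>

text \<open>A coefficient family is indexed by the exponent vectors in \<open>cube m\<close>.\<close>

definition anf_eval :: "nat \<Rightarrow> nat \<Rightarrow> ((nat \<Rightarrow> nat) \<Rightarrow> int) \<Rightarrow> (nat \<Rightarrow> nat) \<Rightarrow> int" where
  "anf_eval m h c =
     (\<lambda>x\<in>cube m. (\<Sum>i\<in>cube m. c i * int (\<Prod>\<alpha><m. x \<alpha> ^ i \<alpha>)) mod 2 ^ h)"

text \<open>Existence and uniqueness are shown in \<open>anf_ex1\<close> below.\<close>

definition anf :: "nat \<Rightarrow> nat \<Rightarrow> ((nat \<Rightarrow> nat) \<Rightarrow> int) \<Rightarrow> (nat \<Rightarrow> nat) \<Rightarrow> int" where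
  "anf m h f = (THE c. c \<in> cube m \<rightarrow>\<^sub>E Zpow2 h \<and> anf_eval m h c = f)"

text \<open>In \<open>ereal\<close> the supremum of the empty set is \<open>- \<infinity>\<close>, the degree of the zero polynomial.\<close>

definition poly_degree :: "nat \<Rightarrow> ((nat \<Rightarrow> nat) \<Rightarrow> int) \<Rightarrow> ereal" where
  "poly_degree m c = (SUP i\<in>{i\<in>cube m. c i \<noteq> 0}. ereal (real (\<Sum>\<alpha><m. i \<alpha>)))"

definition effective_degree :: "nat \<Rightarrow> nat \<Rightarrow> ((nat \<Rightarrow> nat) \<Rightarrow> int) \<Rightarrow> ereal" where
  "effective_degree m h f =
     (MAX i\<in>{..<h}. poly_degree m (\<lambda>j. anf m h f j mod 2 ^ (i + 1)) - ereal (real i))"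

definition \<F> :: "int \<Rightarrow> nat \<Rightarrow> nat \<Rightarrow> ((nat \<Rightarrow> nat) \<Rightarrow> int) set" where
  "\<F> \<rho> m h =
     {f \<in> gen_boolean_functions m h. effective_degree m h f \<le> ereal (real_of_int \<rho>)}"


subsection \<open>Words and codes\<close>

definition words :: "nat \<Rightarrow> nat \<Rightarrow> (nat \<Rightarrow> int) set" where
  "words n h = {..<n} \<rightarrow>\<^sub>E Zpow2 h"

definition binary_digits :: "nat \<Rightarrow> nat \<Rightarrow> nat \<Rightarrow> nat" where
  "binary_digits m i = (\<lambda>\<alpha>\<in>{..<m}. i div 2 ^ \<alpha> mod 2)"

definition assoc_word :: "nat \<Rightarrow> ((nat \<Rightarrow> nat) \<Rightarrow> int) \<Rightarrow> nat \<Rightarrow> int" where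
  "assoc_word m f = (\<lambda>i\<in>{..<2 ^ m}. f (binary_digits m i))"

text \<open>The last \<open>k\<close> of the coordinates \<open>x 0, \<dots>, x (m - 1)\<close>, renumbered from \<open>0\<close>.\<close>

definition last_coords :: "nat \<Rightarrow> nat \<Rightarrow> (nat \<Rightarrow> nat) \<Rightarrow> nat \<Rightarrow> nat" where
  "last_coords k m x = (\<lambda>j\<in>{..<k}. x (m - k + j))"

definition \<A> :: "nat \<Rightarrow> nat \<Rightarrow> nat \<Rightarrow> nat \<Rightarrow> (nat \<Rightarrow> int) set" where
  "\<A> k r m h =
     {assoc_word m (\<lambda>x. ((\<Sum>i<m - k. int (x i) * gs i (last_coords k m x))
                          + g (last_coords k m x)) mod 2 ^ h)
      | gs g. (\<forall>i<m - k. gs i \<in> \<F> (int r - 1) k h) \<and> g \<in> \<F> (int r) k h}"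

definition \<R> :: "nat \<Rightarrow> nat \<Rightarrow> nat \<Rightarrow> (nat \<Rightarrow> int) set" where
  "\<R> k m h =
     {assoc_word m (\<lambda>x. (2 ^ (h - 1) *
         (\<Sum>d\<in>cube k. \<Sum>i<m - k - 1.
            int (x (\<pi> d i) * x (\<pi> d (i + 1)) *
              (\<Prod>j<k. x (m - k + j) ^ d j * (1 - x (m - k + j)) ^ (1 - d j))))) mod 2 ^ h)
      | \<pi>. \<forall>d\<in>cube k. \<pi> d permutes {..<m - k}}"

definition word_add :: "nat \<Rightarrow> nat \<Rightarrow> (nat \<Rightarrow> int) \<Rightarrow> (nat \<Rightarrow> int) \<Rightarrow> nat \<Rightarrow> int" where
  "word_add n h a b = (\<lambda>i\<in>{..<n}. (a i + b i) mod 2 ^ h)"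

definition word_diff :: "nat \<Rightarrow> nat \<Rightarrow> (nat \<Rightarrow> int) \<Rightarrow> (nat \<Rightarrow> int) \<Rightarrow> nat \<Rightarrow> int" where
  "word_diff n h a b = (\<lambda>i\<in>{..<n}. (a i - b i) mod 2 ^ h)"

definition is_coset :: "nat \<Rightarrow> nat \<Rightarrow> (nat \<Rightarrow> int) set \<Rightarrow> (nat \<Rightarrow> int) set \<Rightarrow> bool" where
  "is_coset n h A C \<longleftrightarrow> (\<exists>a\<in>words n h. C = word_add n h a ` A)"


subsection \<open>Power control\<close>

definition root_of_unity :: "nat \<Rightarrow> complex" where
  "root_of_unity h = exp (2 * of_real pi * \<i> / 2 ^ h)"

definition polyphase :: "nat \<Rightarrow> (nat \<Rightarrow> int) \<Rightarrow> nat \<Rightarrow> complex" where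
  "polyphase h c = (\<lambda>i. root_of_unity h powi c i)"

definition PMEPR :: "real \<Rightarrow> nat \<Rightarrow> (nat \<Rightarrow> complex) \<Rightarrow> real" where
  "PMEPR \<zeta> n C =
     1 / real n *
     (SUP \<theta>\<in>{0..<1}.
        (cmod (\<Sum>i<n. C i * exp (2 * of_real pi * \<i> * of_real ((real i + \<zeta>) * \<theta>))))\<^sup>2)"


subsection \<open>Distances\<close>

definition lee_weight :: "nat \<Rightarrow> nat \<Rightarrow> (nat \<Rightarrow> int) \<Rightarrow> int" where
  "lee_weight n h a = (\<Sum>i<n. min (a i) (2 ^ h - a i))"

definition sq_euclidean_weight :: "nat \<Rightarrow> nat \<Rightarrow> (nat \<Rightarrow> int) \<Rightarrow> real" where
  "sq_euclidean_weight n h a = (\<Sum>i<n. (cmod (root_of_unity h powi a i - 1))\<^sup>2)"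

definition lee_distance :: "nat \<Rightarrow> nat \<Rightarrow> (nat \<Rightarrow> int) \<Rightarrow> (nat \<Rightarrow> int) \<Rightarrow> int" where
  "lee_distance n h a b = lee_weight n h (word_diff n h a b)"

definition sq_euclidean_distance :: "nat \<Rightarrow> nat \<Rightarrow> (nat \<Rightarrow> int) \<Rightarrow> (nat \<Rightarrow> int) \<Rightarrow> real" where
  "sq_euclidean_distance n h a b = sq_euclidean_weight n h (word_diff n h a b)"

definition minimum_distance ::
  "((nat \<Rightarrow> int) \<Rightarrow> (nat \<Rightarrow> int) \<Rightarrow> 'a::linorder) \<Rightarrow> (nat \<Rightarrow> int) set \<Rightarrow> 'a" where
  "minimum_distance dst C = Min {dst a b | a b. a \<in> C \<and> b \<in> C \<and> a \<noteq> b}"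


subsection \<open>Existence and uniqueness of the algebraic normal form\<close>

lemma finite_cube [simp]: "finite (cube m)"
  unfolding cube_def by (intro finite_PiE) auto

lemma anf_eval_alt:
  assumes "x \<in> cube m"
  shows "anf_eval m h c x = (\<Sum>i | i \<in> cube m \<and> (\<forall>\<alpha><m. i \<alpha> \<le> x \<alpha>). c i) mod 2 ^ h"
proof -
  have prod01: "(\<Prod>\<alpha><m. x \<alpha> ^ i \<alpha>) = (if \<forall>\<alpha><m. i \<alpha> \<le> x \<alpha> then 1 else 0)" if i: "i \<in> cube m" for i
  proof -
    have factor: "x \<alpha> ^ i \<alpha> = (if i \<alpha> \<le> x \<alpha> then 1 else 0)" if "\<alpha> < m" for \<alpha>
    proof -
      have "x \<alpha> \<in> {0, 1}" "i \<alpha> \<in> {0, 1}"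
        using assms i that by (auto simp: cube_def dest!: PiE_mem)
      then show ?thesis by auto
    qed
    have "(\<Prod>\<alpha><m. x \<alpha> ^ i \<alpha>) = (\<Prod>\<alpha><m. if i \<alpha> \<le> x \<alpha> then 1 else 0)"
      by (intro prod.cong) (auto simp: factor)
    also have "\<dots> = (if \<forall>\<alpha><m. i \<alpha> \<le> x \<alpha> then 1 else 0)"
    proof (cases "\<forall>\<alpha><m. i \<alpha> \<le> x \<alpha>")
      case True
      then show ?thesis by simp
    next
      case False
      then obtain \<beta> where "\<beta> < m" "\<not> i \<beta> \<le> x \<beta>" by blast
      then have "(\<Prod>\<alpha><m. if i \<alpha> \<le> x \<alpha> then 1 else (0::nat)) = 0"
        by (intro prod_zero) auto
      then show ?thesis using False by simp
    qed
    finally show ?thesis .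
  qed
  have "(\<Sum>i\<in>cube m. c i * int (\<Prod>\<alpha><m. x \<alpha> ^ i \<alpha>)) =
        (\<Sum>i\<in>cube m. if \<forall>\<alpha><m. i \<alpha> \<le> x \<alpha> then c i else 0)"
    by (intro sum.cong) (auto simp: prod01)
  also have "\<dots> = (\<Sum>i | i \<in> cube m \<and> (\<forall>\<alpha><m. i \<alpha> \<le> x \<alpha>). c i)"
    by (simp add: sum.inter_filter)
  finally show ?thesis using assms by (simp add: anf_eval_def)
qed

lemma anf_eval_inj: "inj_on (anf_eval m h) (cube m \<rightarrow>\<^sub>E Zpow2 h)"
proof (rule inj_onI)
  fix c c'
  assume c: "c \<in> cube m \<rightarrow>\<^sub>E Zpow2 h" and c': "c' \<in> cube m \<rightarrow>\<^sub>E Zpow2 h"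
    and eq: "anf_eval m h c = anf_eval m h c'"
  have "c x = c' x" if "x \<in> cube m" for x
    using that
  proof (induction "\<Sum>\<alpha><m. x \<alpha>" arbitrary: x rule: less_induct)
    case less
    let ?D = "{i. i \<in> cube m \<and> (\<forall>\<alpha><m. i \<alpha> \<le> x \<alpha>)}"
    have IH: "c i = c' i" if i: "i \<in> ?D - {x}" for i
    proof -
      have "\<exists>\<alpha><m. i \<alpha> \<noteq> x \<alpha>"
      proof (rule ccontr)
        assume "\<not> ?thesis"
        then have "i = x" using i less.prems
          by (intro PiE_ext[where k = "{..<m}" and s = "\<lambda>_. {0, 1}"]) (auto simp: cube_def)
        with i show False by simp
      qed
      then have "(\<Sum>\<alpha><m. i \<alpha>) < (\<Sum>\<alpha><m. x \<alpha>)"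
        using i by (intro sum_strict_mono_ex1) (auto simp: order.order_iff_strict)
      then show ?thesis using less.hyps i by auto
    qed
    have split: "(\<Sum>i\<in>?D. d i) = d x + (\<Sum>i\<in>?D - {x}. d i)" for d :: "(nat \<Rightarrow> nat) \<Rightarrow> int"
      using less.prems by (intro sum.remove) auto
    have "(\<Sum>i\<in>?D - {x}. c i) = (\<Sum>i\<in>?D - {x}. c' i)"
      using IH by (intro sum.cong) auto
    moreover have "(\<Sum>i\<in>?D. c i) mod 2 ^ h = (\<Sum>i\<in>?D. c' i) mod 2 ^ h"
      using fun_cong[OF eq, of x] less.prems by (simp add: anf_eval_alt)
    ultimately have "(c x + (\<Sum>i\<in>?D - {x}. c' i)) mod 2 ^ h = (c' x + (\<Sum>i\<in>?D - {x}. c' i)) mod 2 ^ h"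
      unfolding split by simp
    then have "c x mod 2 ^ h = c' x mod 2 ^ h"
      by (simp add: mod_eq_dvd_iff)
    moreover have "c x \<in> Zpow2 h" "c' x \<in> Zpow2 h"
      using c c' less.prems by (auto dest: PiE_mem)
    ultimately show ?case by simp
  qed
  then show "c = c'" by (rule PiE_ext[OF c c'])
qed

lemma anf_ex1:
  assumes "f \<in> gen_boolean_functions m h"
  shows "\<exists>!c. c \<in> cube m \<rightarrow>\<^sub>E Zpow2 h \<and> anf_eval m h c = f"
proof -
  let ?S = "cube m \<rightarrow>\<^sub>E Zpow2 h"
  have "finite ?S" by (intro finite_PiE) auto
  moreover have "anf_eval m h ` ?S \<subseteq> ?S" by (auto simp: anf_eval_def)
  ultimately have surj: "anf_eval m h ` ?S = ?S"
    using anf_eval_inj by (intro endo_inj_surj)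
  have "f \<in> anf_eval m h ` ?S"
    unfolding surj using assms by (simp only: gen_boolean_functions_def)
  then obtain c where c: "c \<in> ?S" "anf_eval m h c = f" by (elim imageE) simp
  show ?thesis
  proof (rule ex1I[of _ c])
    show "c' = c" if "c' \<in> ?S \<and> anf_eval m h c' = f" for c'
      using that c by (intro inj_onD[OF anf_eval_inj, of m h c' c]) simp_all
  qed (use c in simp)
qed

end

theory Submission
  imports Defs
begin

text \<open>
  A function has effective degree at most \<open>\<rho>\<close> iff the coefficient of each monomial of degree \<open>w\<close>
  is divisible by \<open>2 ^ (w - \<rho>)\<close>; counting coefficient families gives the size of the codes.

  For the distances, let \<open>2 ^ j\<close> be the exact power of two dividing all coefficients of a nonzero
  codeword, and let \<open>S\<close> be a maximal monomial whose coefficient is nonzero modulo \<open>2 ^ (j + 1)\<close>,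
  so \<open>card S \<le> r + j\<close>. However the variables outside \<open>S\<close> are fixed, the restriction is nonzero
  modulo \<open>2 ^ (j + 1)\<close>. Hence at least \<open>2 ^ (m - r - j)\<close> entries are nonzero multiples of
  \<open>2 ^ j\<close>, each of which contributes at least \<open>2 ^ j\<close> times the weight of the entry \<open>1\<close>.

  For the PMEPR, fixing the last \<open>k\<close> variables turns a word into a member of a Golay pair of length
  \<open>2 ^ (m - k)\<close>, whose transform has squared modulus at most \<open>2 ^ (m - k + 1)\<close>; the triangle
  inequality over the \<open>2 ^ k\<close> restrictions costs a factor \<open>2 ^ (2 * k)\<close>.
\<close>

section \<open>Points of the cube\<close>

text \<open>Monomials and evaluation points are both elements of \<open>cube m\<close>, so one
  indicator-vector encoding of sets serves for exponents and for arguments.\<close>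

definition point :: "nat \<Rightarrow> nat set \<Rightarrow> nat \<Rightarrow> nat" where
  "point m S = (\<lambda>\<alpha>\<in>{..<m}. if \<alpha> \<in> S then 1 else 0)"

lemma point_in_cube [simp]: "point m S \<in> cube m"
  by (auto simp: point_def cube_def)

lemma bij_betw_point: "bij_betw (point m) (Pow {..<m}) (cube m)"
proof (rule bij_betw_byWitness[where f' = "\<lambda>x. {\<alpha>\<in>{..<m}. x \<alpha> = 1}"])
  show "\<forall>x\<in>cube m. point m {\<alpha> \<in> {..<m}. x \<alpha> = 1} = x"
  proof
    fix x assume x: "x \<in> cube m"
    show "point m {\<alpha> \<in> {..<m}. x \<alpha> = 1} = x"
    proof
      fix \<alpha>
      show "point m {\<alpha> \<in> {..<m}. x \<alpha> = 1} \<alpha> = x \<alpha>"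
        using x by (cases "\<alpha> < m") (auto simp: cube_def point_def PiE_def Pi_def extensional_def)
    qed
  qed
qed (auto, auto simp: point_def split: if_splits)

lemma cube_pointE:
  assumes "x \<in> cube m" obtains S where "S \<subseteq> {..<m}" "x = point m S"
  using assms bij_betw_imp_surj_on[OF bij_betw_point[of m]] by auto

lemma sum_cube_point: "(\<Sum>x\<in>cube m. f x) = (\<Sum>S\<in>Pow {..<m}. f (point m S))"
  by (rule sum.reindex_bij_betw[OF bij_betw_point, symmetric])

lemma card_cube: "card (cube m) = 2 ^ m"
  using bij_betw_same_card[OF bij_betw_point, of m] by (simp add: card_Pow)

lemma prod_point:
  assumes "T \<subseteq> {..<m}"
  shows "(\<Prod>\<alpha>\<in>T. point m S \<alpha>) = (if T \<subseteq> S then 1 else 0)"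
proof -
  have "finite T" using assms finite_subset by blast
  have "(\<Prod>\<alpha>\<in>T. point m S \<alpha>) = (\<Prod>\<alpha>\<in>T. if \<alpha> \<in> S then 1 else 0)"
    using assms by (intro prod.cong) (auto simp: point_def)
  also have "\<dots> = (if T \<subseteq> S then 1 else 0)"
  proof (cases "T \<subseteq> S")
    case True
    then have "(\<Prod>\<alpha>\<in>T. if \<alpha> \<in> S then 1 else 0) = (1::nat)" by (intro prod.neutral) auto
    then show ?thesis using True by simp
  next
    case False
    then show ?thesis using \<open>finite T\<close> by (auto intro!: bexI)
  qed
  finally show ?thesis .
qed

text \<open>Links the exponent-vector form of a monomial in \<open>anf_eval\<close> with the
  set-indexed form in \<open>effective_polys\<close>.\<close>

lemma prod_power_point:
  assumes "T \<subseteq> {..<m}"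
  shows "(\<Prod>\<alpha><m. x \<alpha> ^ point m T \<alpha>) = (\<Prod>\<alpha>\<in>T. x \<alpha> :: nat)"
proof -
  have "(\<Prod>\<alpha><m. x \<alpha> ^ point m T \<alpha>) = (\<Prod>\<alpha><m. if \<alpha> \<in> T then x \<alpha> else 1)"
    by (intro prod.cong) (auto simp: point_def)
  also have "\<dots> = (\<Prod>\<alpha>\<in>{..<m} \<inter> T. x \<alpha>)"
    by (subst prod.inter_restrict) auto
  also have "{..<m} \<inter> T = T" using assms by auto
  finally show ?thesis .
qed

lemma sum_point:
  assumes "T \<subseteq> {..<m}"
  shows "(\<Sum>\<alpha><m. point m T \<alpha>) = card T"
proof -
  have "(\<Sum>\<alpha><m. point m T \<alpha>) = (\<Sum>\<alpha><m. if \<alpha> \<in> T then 1 else 0)"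
    by (intro sum.cong) (auto simp: point_def)
  also have "\<dots> = card ({..<m} \<inter> T)" by (simp add: sum.If_cases Int_def)
  also have "{..<m} \<inter> T = T" using assms by auto
  finally show ?thesis .
qed

section \<open>Binary digits and the indexing of words by cube points\<close>

lemma sum_binary_digits: "i < 2 ^ m \<Longrightarrow> (\<Sum>\<alpha><m. i div 2 ^ \<alpha> mod 2 * 2 ^ \<alpha>) = (i :: nat)"
proof (induction m arbitrary: i)
  case (Suc m)
  have "(\<Sum>\<alpha><Suc m. i div 2 ^ \<alpha> mod 2 * 2 ^ \<alpha>) =
        i mod 2 + 2 * (\<Sum>\<alpha><m. i div 2 div 2 ^ \<alpha> mod 2 * 2 ^ \<alpha>)"
    by (subst sum.lessThan_Suc_shift)
       (simp add: sum_distrib_left div_mult2_eq algebra_simps)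
  also have "(\<Sum>\<alpha><m. i div 2 div 2 ^ \<alpha> mod 2 * 2 ^ \<alpha>) = i div 2"
    using Suc.prems by (intro Suc.IH) auto
  finally show ?case by simp
qed simp

lemma bij_betw_binary_digits: "bij_betw (binary_digits m) {..<2 ^ m} (cube m)"
proof -
  have inj: "inj_on (binary_digits m) {..<2 ^ m}"
  proof (rule inj_onI)
    fix i j assume ij: "i \<in> {..<2 ^ m}" "j \<in> {..<2 ^ m}" "binary_digits m i = binary_digits m j"
    have "i div 2 ^ \<alpha> mod 2 = j div 2 ^ \<alpha> mod 2" if "\<alpha> < m" for \<alpha>
      using fun_cong[OF ij(3), of \<alpha>] that by (simp add: binary_digits_def)
    then have "(\<Sum>\<alpha><m. i div 2 ^ \<alpha> mod 2 * 2 ^ \<alpha>) = (\<Sum>\<alpha><m. j div 2 ^ \<alpha> mod 2 * 2 ^ \<alpha>)"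
      by (intro sum.cong) auto
    then show "i = j" using ij by (simp add: sum_binary_digits)
  qed
  \<comment> \<open>Surjectivity comes from counting: the injective image lies in the cube, and both
    have \<open>2 ^ m\<close> elements.\<close>
  moreover have "binary_digits m ` {..<2 ^ m} = cube m"
  proof (rule card_subset_eq)
    show "binary_digits m ` {..<2 ^ m} \<subseteq> cube m"
    proof
      fix x assume "x \<in> binary_digits m ` {..<2 ^ m}"
      then obtain i where "x = binary_digits m i" by auto
      then show "x \<in> cube m"
        by (auto simp: cube_def binary_digits_def PiE_def Pi_def)
    qed
  qed (simp_all add: card_image[OF inj] card_cube)
  ultimately show ?thesis by (simp add: bij_betw_def)
qed

lemma binary_digits_in_cube: "i < 2 ^ m \<Longrightarrow> binary_digits m i \<in> cube m"
  using bij_betwE[OF bij_betw_binary_digits] by auto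

lemma assoc_word_eqD:
  assumes "assoc_word m f = assoc_word m g" "x \<in> cube m"
  shows "f x = g x"
proof -
  obtain i where "i < 2 ^ m" "x = binary_digits m i"
    using assms(2) bij_betw_imp_surj_on[OF bij_betw_binary_digits[of m]] by auto
  then show ?thesis using fun_cong[OF assms(1), of i] by (simp add: assoc_word_def)
qed

lemma assoc_word_cong:
  assumes "\<And>x. x \<in> cube m \<Longrightarrow> f x = g x" shows "assoc_word m f = assoc_word m g"
  using assms by (auto simp: assoc_word_def binary_digits_in_cube)

lemma sum_word:
  "(\<Sum>i<2 ^ m. f (binary_digits m i)) = (\<Sum>x\<in>cube m. f x)"
  by (rule sum.reindex_bij_betw[OF bij_betw_binary_digits])

lemma last_coords_in_cube:
  assumes "x \<in> cube m" "k \<le> m" shows "last_coords k m x \<in> cube k"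
  using assms by (auto simp: last_coords_def cube_def PiE_def Pi_def)

section \<open>Effective polynomials\<close>

text \<open>Representing polynomials with possibly unreduced integer coefficients; on the cube every
  monomial is squarefree and hence indexed by a set of variables.\<close>

definition effective_polys :: "int \<Rightarrow> nat \<Rightarrow> ((nat \<Rightarrow> nat) \<Rightarrow> int) set" where
  "effective_polys r m =
     {P. \<exists>p. (\<forall>S\<subseteq>{..<m}. 2 ^ nat (int (card S) - r) dvd p S) \<and>
             (\<forall>x\<in>cube m. P x = (\<Sum>S\<in>Pow {..<m}. p S * int (\<Prod>\<alpha>\<in>S. x \<alpha>)))}"

lemma effective_polys_cong:
  assumes "P \<in> effective_polys r m" "\<And>x. x \<in> cube m \<Longrightarrow> Q x = P x"
  shows "Q \<in> effective_polys r m"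
  using assms by (auto simp: effective_polys_def)

lemma effective_polys_diff:
  assumes "P \<in> effective_polys r m" "Q \<in> effective_polys r m"
  shows "(\<lambda>x. P x - Q x) \<in> effective_polys r m"
proof -
  from assms obtain p q where
    "\<forall>S\<subseteq>{..<m}. 2 ^ nat (int (card S) - r) dvd p S"
    "\<forall>x\<in>cube m. P x = (\<Sum>S\<in>Pow {..<m}. p S * int (\<Prod>\<alpha>\<in>S. x \<alpha>))"
    "\<forall>S\<subseteq>{..<m}. 2 ^ nat (int (card S) - r) dvd q S"
    "\<forall>x\<in>cube m. Q x = (\<Sum>S\<in>Pow {..<m}. q S * int (\<Prod>\<alpha>\<in>S. x \<alpha>))"
    unfolding effective_polys_def by blast
  then show ?thesis
    unfolding effective_polys_def mem_Collect_eq
    by (intro exI[of _ "\<lambda>S. p S - q S"])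
       (auto simp: left_diff_distrib sum_subtractf simp del: of_nat_prod)
qed

lemma effective_polys_add:
  assumes "P \<in> effective_polys r m" "Q \<in> effective_polys r m"
  shows "(\<lambda>x. P x + Q x) \<in> effective_polys r m"
proof -
  from assms obtain p q where
    "\<forall>S\<subseteq>{..<m}. 2 ^ nat (int (card S) - r) dvd p S"
    "\<forall>x\<in>cube m. P x = (\<Sum>S\<in>Pow {..<m}. p S * int (\<Prod>\<alpha>\<in>S. x \<alpha>))"
    "\<forall>S\<subseteq>{..<m}. 2 ^ nat (int (card S) - r) dvd q S"
    "\<forall>x\<in>cube m. Q x = (\<Sum>S\<in>Pow {..<m}. q S * int (\<Prod>\<alpha>\<in>S. x \<alpha>))"
    unfolding effective_polys_def by blast
  then show ?thesis
    unfolding effective_polys_def mem_Collect_eq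
    by (intro exI[of _ "\<lambda>S. p S + q S"])
       (auto simp: distrib_right sum.distrib simp del: of_nat_prod)
qed

lemma effective_polys_zero: "(\<lambda>x. 0) \<in> effective_polys r m"
  unfolding effective_polys_def mem_Collect_eq by (intro exI[of _ "\<lambda>S. 0"]) auto

lemma effective_polys_sum:
  assumes "\<And>i. i \<in> I \<Longrightarrow> P i \<in> effective_polys r m"
  shows "(\<lambda>x. \<Sum>i\<in>I. P i x) \<in> effective_polys r m"
  using assms
  by (induction I rule: infinite_finite_induct)
     (auto intro: effective_polys_zero effective_polys_add)

lemma effective_polys_monomial:
  assumes S: "S \<subseteq> {..<m}" and dvd: "2 ^ nat (int (card S) - r) dvd a"
  shows "(\<lambda>x. a * int (\<Prod>\<alpha>\<in>S. x \<alpha>)) \<in> effective_polys r m"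
proof -
  have "a * int (\<Prod>\<alpha>\<in>S. x \<alpha>) =
    (\<Sum>T\<in>Pow {..<m}. (if T = S then a else 0) * int (\<Prod>\<alpha>\<in>T. x \<alpha>))" for x :: "nat \<Rightarrow> nat"
  proof -
    have "(\<Sum>T\<in>Pow {..<m}. (if T = S then a else 0) * int (\<Prod>\<alpha>\<in>T. x \<alpha>)) =
      (\<Sum>T\<in>Pow {..<m}. if T = S then a * int (\<Prod>\<alpha>\<in>T. x \<alpha>) else 0)"
      by (intro sum.cong) auto
    also have "\<dots> = a * int (\<Prod>\<alpha>\<in>S. x \<alpha>)" using S by (subst sum.delta) auto
    finally show ?thesis by simp
  qed
  then show ?thesis using dvd
    unfolding effective_polys_def mem_Collect_eq
    by (intro exI[of _ "\<lambda>T. if T = S then a else 0"]) (auto simp del: of_nat_prod)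
qed

text \<open>On the cube \<open>x i * x i = x i\<close>, so multiplying by \<open>x i\<close> just
  inserts \<open>i\<close> into each monomial. Degrees grow by at most one, and the divisibility
  conditions for \<open>r\<close> become those for \<open>r + 1\<close>.\<close>

lemma effective_polys_mult_var:
  assumes i: "i < m" and P: "P \<in> effective_polys r m"
  shows "(\<lambda>x. int (x i) * P x) \<in> effective_polys (r + 1) m"
proof -
  obtain p where p: "\<And>S. S \<subseteq> {..<m} \<Longrightarrow> 2 ^ nat (int (card S) - r) dvd p S"
    "\<And>x. x \<in> cube m \<Longrightarrow> P x = (\<Sum>S\<in>Pow {..<m}. p S * int (\<Prod>\<alpha>\<in>S. x \<alpha>))"
    using P unfolding effective_polys_def by blast
  \<comment> \<open>Different \<open>S\<close> may give the same \<open>insert i S\<close>; closure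
    under sums collects these coefficients.\<close>
  have "(\<lambda>x. \<Sum>S\<in>Pow {..<m}. p S * int (\<Prod>\<alpha>\<in>insert i S. x \<alpha>)) \<in> effective_polys (r + 1) m"
  proof (intro effective_polys_sum effective_polys_monomial)
    fix S assume S: "S \<in> Pow {..<m}"
    then have "finite S" using finite_subset by auto
    then have "card (insert i S) \<le> Suc (card S)" by (simp add: card_insert_if)
    then have "(2::int) ^ nat (int (card (insert i S)) - (r + 1)) dvd 2 ^ nat (int (card S) - r)"
      by (intro le_imp_power_dvd nat_mono) auto
    then show "2 ^ nat (int (card (insert i S)) - (r + 1)) dvd p S"
      using p(1)[of S] S dvd_trans by blast
    show "insert i S \<subseteq> {..<m}" using i S by auto
  qed
  then show ?thesis
  proof (rule effective_polys_cong)
    fix x assume x: "x \<in> cube m"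
    have xi: "x i * x i = x i" using x i by (auto simp: cube_def PiE_def Pi_def)
    have "x i * (\<Prod>\<alpha>\<in>S. x \<alpha>) = (\<Prod>\<alpha>\<in>insert i S. x \<alpha>)" if "S \<subseteq> {..<m}" for S
    proof -
      have "finite S" using that finite_subset by auto
      then show ?thesis
        using xi by (cases "i \<in> S") (auto simp: insert_absorb prod.remove mult.assoc[symmetric])
    qed
    then have "int (x i) * int (\<Prod>\<alpha>\<in>S. x \<alpha>) = int (\<Prod>\<alpha>\<in>insert i S. x \<alpha>)"
      if "S \<subseteq> {..<m}" for S using that by (metis of_nat_mult)
    then show "int (x i) * P x = (\<Sum>S\<in>Pow {..<m}. p S * int (\<Prod>\<alpha>\<in>insert i S. x \<alpha>))"
      unfolding p(2)[OF x] sum_distrib_left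
      by (intro sum.cong) (auto simp: mult.left_commute simp del: of_nat_prod)
  qed
qed

text \<open>Renaming variable \<open>j\<close> to \<open>m - k + j\<close> is injective, so the
  degrees of the monomials, and with them the divisibility conditions, are unchanged.\<close>

lemma effective_polys_last_coords:
  assumes P: "P \<in> effective_polys r k" and k: "k \<le> m"
  shows "(\<lambda>x. P (last_coords k m x)) \<in> effective_polys r m"
proof -
  obtain p where p: "\<And>S. S \<subseteq> {..<k} \<Longrightarrow> 2 ^ nat (int (card S) - r) dvd p S"
    "\<And>x. x \<in> cube k \<Longrightarrow> P x = (\<Sum>S\<in>Pow {..<k}. p S * int (\<Prod>\<alpha>\<in>S. x \<alpha>))"
    using P unfolding effective_polys_def by blast
  have "(\<lambda>x. \<Sum>S\<in>Pow {..<k}. p S * int (\<Prod>\<alpha>\<in>(+) (m - k) ` S. x \<alpha>)) \<in> effective_polys r m"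
  proof (intro effective_polys_sum effective_polys_monomial)
    fix S assume S: "S \<in> Pow {..<k}"
    show "2 ^ nat (int (card ((+) (m - k) ` S)) - r) dvd p S"
      using p(1)[of S] S by (simp add: card_image)
    show "(+) (m - k) ` S \<subseteq> {..<m}" using k S by auto
  qed
  then show ?thesis
  proof (rule effective_polys_cong)
    fix x assume x: "x \<in> cube m"
    have "(\<Prod>\<alpha>\<in>S. last_coords k m x \<alpha>) = (\<Prod>\<alpha>\<in>(+) (m - k) ` S. x \<alpha>)" if "S \<subseteq> {..<k}" for S
      using that by (subst prod.reindex) (auto simp: last_coords_def intro!: prod.cong)
    then show "P (last_coords k m x) =
        (\<Sum>S\<in>Pow {..<k}. p S * int (\<Prod>\<alpha>\<in>(+) (m - k) ` S. x \<alpha>))"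
      unfolding p(2)[OF last_coords_in_cube[OF x k]]
      by (intro sum.cong) (auto simp del: of_nat_prod)
  qed
qed

section \<open>Minimum weight\<close>

text \<open>A sign-free Moebius inversion: \<open>q S\<close> is the sum over \<open>Pow S\<close>
  minus the terms at proper subsets, which are divisible by induction.\<close>

lemma dvd_of_dvd_subset_sums:
  fixes q :: "'a set \<Rightarrow> 'b :: comm_ring_1"
  assumes "finite S" "\<And>V. V \<subseteq> S \<Longrightarrow> n dvd (\<Sum>W\<in>Pow V. q W)"
  shows "n dvd q S"
  using assms
proof (induction S rule: finite_psubset_induct)
  case (psubset S)
  have "n dvd q W" if "W \<in> Pow S - {S}" for W
    using that psubset.prems by (intro psubset.IH) auto
  then have "n dvd (\<Sum>W\<in>Pow S - {S}. q W)" by (rule dvd_sum)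
  moreover have "(\<Sum>W\<in>Pow S. q W) = q S + (\<Sum>W\<in>Pow S - {S}. q W)"
    using psubset.hyps by (intro sum.remove) auto
  ultimately show ?case using psubset.prems[of S] by (simp add: dvd_add_left_iff)
qed

lemma sum_Pow_Un:
  assumes "finite V" "finite U" "V \<inter> U = {}"
  shows "(\<Sum>W\<in>Pow (V \<union> U). f W) = (\<Sum>V'\<in>Pow V. \<Sum>U'\<in>Pow U. f (V' \<union> U'))"
proof -
  have "bij_betw (\<lambda>(V', U'). V' \<union> U') (Pow V \<times> Pow U) (Pow (V \<union> U))"
    using assms(3)
    by (intro bij_betw_byWitness[where f' = "\<lambda>W. (W \<inter> V, W \<inter> U)"]) auto
  from sum.reindex_bij_betw[OF this, of f] show ?thesis
    by (simp add: sum.cartesian_product case_prod_beta)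
qed

text \<open>At an indicator point exactly the monomials inside \<open>X\<close> survive, with value
  1. Evaluation thus becomes a subset sum of coefficients, the form that
  \<open>dvd_of_dvd_subset_sums\<close> inverts.\<close>

lemma effective_poly_at_point:
  assumes "\<forall>x\<in>cube m. P x = (\<Sum>S\<in>Pow {..<m}. p S * int (\<Prod>\<alpha>\<in>S. x \<alpha>))" "X \<subseteq> {..<m}"
  shows "P (point m X) = (\<Sum>S\<in>Pow X. p S)"
proof -
  have "P (point m X) = (\<Sum>S\<in>Pow {..<m}. if S \<in> Pow X then p S else 0)"
    using assms(1) by (auto simp: prod_point simp del: of_nat_prod intro!: sum.cong)
  also have "\<dots> = (\<Sum>S\<in>Pow {..<m} \<inter> Pow X. p S)" by (subst sum.inter_restrict) auto
  also have "Pow {..<m} \<inter> Pow X = Pow X" using assms(2) by auto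
  finally show ?thesis .
qed

text \<open>The points are counted with weight \<open>2 ^ j\<close>: few nonzero values are possible
  only when all values carry a high power of two, which the weights below reward in the same
  proportion.\<close>

lemma effective_poly_many_nonzeros:
  fixes r :: nat
  assumes P: "P \<in> effective_polys (int r) m"
    and nz: "\<exists>x\<in>cube m. \<not> 2 ^ h dvd P x"
  obtains j T where "j < h" "T \<subseteq> cube m" "2 ^ (m - r) \<le> card T * 2 ^ j"
    "\<And>x. x \<in> T \<Longrightarrow> \<not> 2 ^ Suc j dvd P x" "\<And>x. x \<in> cube m \<Longrightarrow> 2 ^ j dvd P x"
proof -
  obtain p where p: "\<And>S. S \<subseteq> {..<m} \<Longrightarrow> 2 ^ nat (int (card S) - int r) dvd p S"
    and Pp: "\<forall>x\<in>cube m. P x = (\<Sum>S\<in>Pow {..<m}. p S * int (\<Prod>\<alpha>\<in>S. x \<alpha>))"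
    using P unfolding effective_polys_def by blast
  define B where "B = (\<lambda>j. {S. S \<subseteq> {..<m} \<and> \<not> 2 ^ Suc j dvd p S})"
  have finB: "finite (B j)" for j
    by (rule finite_subset[of _ "Pow {..<m}"]) (auto simp: B_def)
  have h0: "h \<noteq> 0" using nz by (metis dvd_triv_left mult_1 power_0)
  have "\<exists>S\<subseteq>{..<m}. \<not> 2 ^ h dvd p S"
  proof (rule ccontr)
    assume "\<not> ?thesis"
    then have "2 ^ h dvd P x" if "x \<in> cube m" for x
      using Pp that by (auto intro!: dvd_sum dvd_mult2 simp del: of_nat_prod)
    then show False using nz by blast
  qed
  moreover have "Suc (h - 1) = h" using h0 by simp
  ultimately have ex: "B (h - 1) \<noteq> {}" unfolding B_def by auto
  \<comment> \<open>Emptiness of \<open>B i\<close> says that \<open>2 ^ Suc i\<close> divides every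
    coefficient, so leastness of \<open>j\<close> gives divisibility by \<open>2 ^ j\<close>.
    Nonemptiness of \<open>B (h - 1)\<close> gives \<open>j < h\<close>.\<close>
  define j where "j = (LEAST j. B j \<noteq> {})"
  have Bj: "B j \<noteq> {}" unfolding j_def by (rule LeastI[of "\<lambda>j. B j \<noteq> {}", OF ex])
  have "j \<le> h - 1" unfolding j_def by (rule Least_le[of "\<lambda>j. B j \<noteq> {}", OF ex])
  then have jh: "j < h" using h0 by simp
  have dj: "2 ^ j dvd p S" if "S \<subseteq> {..<m}" for S
  proof (cases j)
    case (Suc i)
    then have "\<not> B i \<noteq> {}" unfolding j_def by (intro not_less_Least) simp
    then show ?thesis using Suc that by (auto simp: B_def)
  qed simp
  obtain S where S: "S \<in> B j" and maxS: "\<And>S'. S' \<in> B j \<Longrightarrow> S \<subseteq> S' \<Longrightarrow> S = S'"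
    using finite_has_maximal[OF finB Bj] by blast
  then have Sm: "S \<subseteq> {..<m}" and nS: "\<not> 2 ^ Suc j dvd p S" by (auto simp: B_def)
  have finS: "finite S" using Sm finite_subset by auto
  \<comment> \<open>A monomial of degree above \<open>r + j\<close> has a coefficient divisible by
    \<open>2 ^ Suc j\<close>, so \<open>S\<close> is not of that kind.\<close>
  have cardS: "card S \<le> r + j"
  proof (rule ccontr)
    assume "\<not> ?thesis"
    then have "(2::int) ^ Suc j dvd 2 ^ nat (int (card S) - int r)"
      by (intro le_imp_power_dvd) simp
    then show False using p[OF Sm] nS dvd_trans by blast
  qed
  \<comment> \<open>Fixing the variables outside \<open>S\<close> leaves the coefficient of \<open>S\<close> unchanged
    modulo \<open>2 ^ (j + 1)\<close>, by maximality of \<open>S\<close>.\<close>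
  have "\<exists>V\<subseteq>S. \<not> 2 ^ Suc j dvd P (point m (V \<union> U))" if U: "U \<subseteq> {..<m} - S" for U
  proof (rule ccontr)
    assume neg: "\<not> ?thesis"
    have finU: "finite U" using U finite_subset by blast
    \<comment> \<open>For \<open>V \<subseteq> S\<close>, \<open>q V\<close> is the coefficient of
      \<open>V\<close> after setting the variables in \<open>U\<close> to 1 and the remaining ones
      outside \<open>S\<close> to 0.\<close>
    define q where "q V = (\<Sum>U'\<in>Pow U. p (V \<union> U'))" for V
    have "2 ^ Suc j dvd (\<Sum>W\<in>Pow V. q W)" if V: "V \<subseteq> S" for V
    proof -
      have "finite V" using V finS finite_subset by auto
      then have "(\<Sum>W\<in>Pow V. q W) = (\<Sum>W\<in>Pow (V \<union> U). p W)"
        unfolding q_def using V U finU by (intro sum_Pow_Un[symmetric]) auto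
      also have "\<dots> = P (point m (V \<union> U))"
        using V U Sm by (intro effective_poly_at_point[OF Pp, symmetric]) auto
      finally show ?thesis using neg V by auto
    qed
    then have "2 ^ Suc j dvd q S" by (rule dvd_of_dvd_subset_sums[OF finS])
    moreover have "q S = p S + (\<Sum>U'\<in>Pow U - {{}}. p (S \<union> U'))"
      unfolding q_def using finU by (subst sum.remove[of _ "{}"]) auto
    moreover have "2 ^ Suc j dvd (\<Sum>U'\<in>Pow U - {{}}. p (S \<union> U'))"
    proof (rule dvd_sum)
      fix U' assume U': "U' \<in> Pow U - {{}}"
      then have "S \<noteq> S \<union> U'" using U by blast
      then have "S \<union> U' \<notin> B j" using maxS[of "S \<union> U'"] by blast
      then show "2 ^ Suc j dvd p (S \<union> U')" using U' U Sm by (auto simp: B_def)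
    qed
    ultimately show False using nS by (simp add: dvd_add_left_iff)
  qed
  \<comment> \<open>One nonzero point is chosen for each setting \<open>U\<close> of the variables
    outside \<open>S\<close>. Removing \<open>S\<close> from its support recovers \<open>U\<close>,
    so these points are distinct.\<close>
  then obtain v where v: "\<And>U. U \<subseteq> {..<m} - S \<Longrightarrow> v U \<subseteq> S"
    "\<And>U. U \<subseteq> {..<m} - S \<Longrightarrow> \<not> 2 ^ Suc j dvd P (point m (v U \<union> U))"
    by metis
  define T where "T = (\<lambda>U. point m (v U \<union> U)) ` Pow ({..<m} - S)"
  have "inj_on (\<lambda>U. v U \<union> U) (Pow ({..<m} - S))"
  proof (rule inj_onI)
    fix U U' assume "U \<in> Pow ({..<m} - S)" "U' \<in> Pow ({..<m} - S)" "v U \<union> U = v U' \<union> U'"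
    moreover have "(v U \<union> U) - S = U" if "U \<in> Pow ({..<m} - S)" for U
      using that v(1)[of U] by auto
    ultimately show "U = U'" by metis
  qed
  moreover have "inj_on (point m) ((\<lambda>U. v U \<union> U) ` Pow ({..<m} - S))"
    using v(1) Sm by (intro inj_on_subset[OF bij_betw_imp_inj_on[OF bij_betw_point]]) blast
  ultimately have "inj_on (\<lambda>U. point m (v U \<union> U)) (Pow ({..<m} - S))"
    using comp_inj_on[of "\<lambda>U. v U \<union> U" _ "point m"] by (simp add: comp_def)
  then have "card T = 2 ^ (m - card S)"
    unfolding T_def using Sm finS by (simp add: card_image card_Pow card_Diff_subset)
  moreover have "(2::nat) ^ (m - r) \<le> 2 ^ (m - card S + j)"
    using cardS by (intro power_increasing) auto
  ultimately have "2 ^ (m - r) \<le> card T * 2 ^ j" by (simp add: power_add)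
  moreover have "2 ^ j dvd P x" if "x \<in> cube m" for x
    using that Pp dj by (auto intro!: dvd_sum dvd_mult2 simp del: of_nat_prod)
  ultimately show thesis using jh v(2)
    by (intro that[of j T]) (auto simp: T_def)
qed

section \<open>Functions of bounded effective degree\<close>

text \<open>The normal forms of the functions of effective degree at most \<open>\<rho>\<close>.
  Monomials of degree at most \<open>\<rho>\<close> are unconstrained, since \<open>nat\<close>
  sends nonpositive differences to 0.\<close>

definition effective_coeffs :: "int \<Rightarrow> nat \<Rightarrow> nat \<Rightarrow> ((nat \<Rightarrow> nat) \<Rightarrow> int) set" where
  "effective_coeffs \<rho> k h =
     (\<Pi>\<^sub>E i\<in>cube k. {c \<in> Zpow2 h. 2 ^ nat (int (\<Sum>\<alpha><k. i \<alpha>) - \<rho>) dvd c})"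

text \<open>Bounds on a maximum or a supremum are bounds on all members. The zero polynomial
  satisfies them vacuously, and \<open>h \<ge> 1\<close> makes the maximum range over a nonempty
  set.\<close>

lemma effective_degree_le_iff:
  assumes h: "h \<ge> 1"
  shows "effective_degree k h f \<le> ereal (real_of_int \<rho>) \<longleftrightarrow>
    (\<forall>i<h. \<forall>j\<in>cube k. anf k h f j mod 2 ^ (i + 1) \<noteq> 0 \<longrightarrow> int (\<Sum>\<alpha><k. j \<alpha>) \<le> \<rho> + int i)"
proof -
  have "poly_degree k c - ereal (real i) \<le> ereal (real_of_int \<rho>) \<longleftrightarrow>
    (\<forall>j\<in>cube k. c j \<noteq> 0 \<longrightarrow> int (\<Sum>\<alpha><k. j \<alpha>) \<le> \<rho> + int i)" for c i
  proof -
    have "poly_degree k c - ereal (real i) \<le> ereal (real_of_int \<rho>) \<longleftrightarrow>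
      poly_degree k c \<le> ereal (real_of_int (\<rho> + int i))"
      by (simp add: ereal_minus_le)
    also have "\<dots> \<longleftrightarrow> (\<forall>j\<in>cube k. c j \<noteq> 0 \<longrightarrow>
        real (\<Sum>\<alpha><k. j \<alpha>) \<le> real_of_int (\<rho> + int i))"
      unfolding poly_degree_def SUP_le_iff by auto
    also have "\<dots> \<longleftrightarrow> (\<forall>j\<in>cube k. c j \<noteq> 0 \<longrightarrow> int (\<Sum>\<alpha><k. j \<alpha>) \<le> \<rho> + int i)"
      by (metis of_int_le_iff of_int_of_nat_eq)
    finally show ?thesis .
  qed
  moreover have "{..<h} \<noteq> {}" using h by (auto simp: lessThan_empty_iff)
  ultimately show ?thesis
    unfolding effective_degree_def by (subst Max_le_iff) auto
qed

text \<open>Level \<open>i\<close> demands divisibility by \<open>2 ^ (i + 1)\<close> whenever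
  \<open>w > \<rho> + i\<close>, so all levels together amount to the strongest one that
  applies.\<close>

lemma effective_coeff_iff:
  fixes c :: int
  assumes "c \<in> Zpow2 h" "h \<ge> 1"
  shows "(\<forall>i<h. c mod 2 ^ (i + 1) \<noteq> 0 \<longrightarrow> w \<le> \<rho> + int i) \<longleftrightarrow> 2 ^ nat (w - \<rho>) dvd c"
proof
  assume H: "\<forall>i<h. c mod 2 ^ (i + 1) \<noteq> 0 \<longrightarrow> w \<le> \<rho> + int i"
  show "2 ^ nat (w - \<rho>) dvd c"
  proof (cases "w \<le> \<rho>")
    case False
    \<comment> \<open>The strongest level: \<open>i + 1\<close> is \<open>w - \<rho>\<close> capped
      at \<open>h\<close>.\<close>
    define i where "i = min (nat (w - \<rho>)) h - 1"
    have "i < h" "\<not> w \<le> \<rho> + int i" using False assms(2) by (auto simp: i_def)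
    then have dvd: "2 ^ (i + 1) dvd c" using H by (auto simp: dvd_eq_mod_eq_0)
    show ?thesis
    proof (cases "nat (w - \<rho>) \<le> h")
      case True
      then show ?thesis using dvd False by (simp add: i_def)
    next
      case False
      \<comment> \<open>When the required power exceeds the modulus, the residue must be 0, which
        every power divides.\<close>
      then have "2 ^ h dvd c" using dvd assms(2) by (simp add: i_def)
      then have "c = 0" using assms(1) zdvd_not_zless[of c "2 ^ h"] by force
      then show ?thesis by simp
    qed
  qed simp
next
  assume dvd: "2 ^ nat (w - \<rho>) dvd c"
  show "\<forall>i<h. c mod 2 ^ (i + 1) \<noteq> 0 \<longrightarrow> w \<le> \<rho> + int i"
  proof (intro allI impI)
    fix i assume "i < h" and nz: "c mod 2 ^ (i + 1) \<noteq> 0"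
    show "w \<le> \<rho> + int i"
    proof (rule ccontr)
      assume "\<not> ?thesis"
      then have "(2::int) ^ (i + 1) dvd 2 ^ nat (w - \<rho>)" by (intro le_imp_power_dvd) auto
      then show False using dvd nz dvd_trans by (metis dvd_imp_mod_0)
    qed
  qed
qed

lemma anf_eval_range: "anf_eval k h c \<in> gen_boolean_functions k h"
  by (auto simp: anf_eval_def gen_boolean_functions_def)

lemma anf_anf_eval: "c \<in> cube k \<rightarrow>\<^sub>E Zpow2 h \<Longrightarrow> anf k h (anf_eval k h c) = c"
  unfolding anf_def
  by (rule the1_equality[OF anf_ex1[OF anf_eval_range]]) simp

lemma anf_spec:
  assumes "f \<in> gen_boolean_functions k h"
  shows "anf k h f \<in> cube k \<rightarrow>\<^sub>E Zpow2 h" "anf_eval k h (anf k h f) = f"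
  using theI'[OF anf_ex1[OF assms]] unfolding anf_def by auto

lemma effective_coeffs_subset: "effective_coeffs \<rho> k h \<subseteq> cube k \<rightarrow>\<^sub>E Zpow2 h"
  unfolding effective_coeffs_def by (intro PiE_mono) auto

lemma effective_coeffs_iff:
  assumes "c \<in> cube k \<rightarrow>\<^sub>E Zpow2 h" "h \<ge> 1"
  shows "effective_degree k h (anf_eval k h c) \<le> ereal (real_of_int \<rho>) \<longleftrightarrow>
    c \<in> effective_coeffs \<rho> k h"
proof -
  have "effective_degree k h (anf_eval k h c) \<le> ereal (real_of_int \<rho>) \<longleftrightarrow>
    (\<forall>j\<in>cube k. \<forall>i<h. c j mod 2 ^ (i + 1) \<noteq> 0 \<longrightarrow> int (\<Sum>\<alpha><k. j \<alpha>) \<le> \<rho> + int i)"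
    unfolding effective_degree_le_iff[OF assms(2)] anf_anf_eval[OF assms(1)] by blast
  also have "\<dots> \<longleftrightarrow> (\<forall>j\<in>cube k. 2 ^ nat (int (\<Sum>\<alpha><k. j \<alpha>) - \<rho>) dvd c j)"
    using assms by (intro ball_cong refl effective_coeff_iff) (auto dest: PiE_mem)
  also have "\<dots> \<longleftrightarrow> c \<in> effective_coeffs \<rho> k h"
    using assms(1) unfolding effective_coeffs_def PiE_iff by auto
  finally show ?thesis .
qed

text \<open>Uniqueness of the normal form makes the effective degree a condition on each coefficient
  separately, so the set can be counted as a product.\<close>

lemma \<F>_eq_image:
  assumes "h \<ge> 1"
  shows "\<F> \<rho> k h = anf_eval k h ` effective_coeffs \<rho> k h"
proof (intro equalityI subsetI)
  fix f assume "f \<in> \<F> \<rho> k h"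
  then have f: "f \<in> gen_boolean_functions k h" "effective_degree k h f \<le> ereal (real_of_int \<rho>)"
    by (auto simp: \<F>_def)
  then show "f \<in> anf_eval k h ` effective_coeffs \<rho> k h"
    using anf_spec[OF f(1)] effective_coeffs_iff[OF _ assms] by (metis imageI)
next
  fix f assume "f \<in> anf_eval k h ` effective_coeffs \<rho> k h"
  then show "f \<in> \<F> \<rho> k h"
    using effective_coeffs_iff[OF _ assms] effective_coeffs_subset anf_eval_range
    unfolding \<F>_def by blast
qed

section \<open>Counting the functions of bounded effective degree\<close>

lemma card_multiples_power2: "card {c \<in> Zpow2 h. 2 ^ e dvd c} = 2 ^ (h - e)"
proof (cases "e \<le> h")
  case True
  then have split: "(2::int) ^ h = 2 ^ e * 2 ^ (h - e)" by (simp flip: power_add)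
  have "{c \<in> Zpow2 h. 2 ^ e dvd c} = (*) (2 ^ e) ` Zpow2 (h - e)"
    unfolding split by (auto simp: zero_le_mult_iff dvd_def image_iff)
  moreover have "inj_on ((*) ((2::int) ^ e)) (Zpow2 (h - e))" by (auto simp: inj_on_def)
  ultimately show ?thesis by (simp add: card_image nat_power_eq)
next
  case False
  \<comment> \<open>For \<open>e > h\<close> only the residue 0 remains, matching
    \<open>2 ^ (h - e) = 1\<close> under truncated subtraction.\<close>
  then have "(2::int) ^ h dvd 2 ^ e" by (intro le_imp_power_dvd) simp
  then have "c = 0" if "c \<in> Zpow2 h" "2 ^ e dvd c" for c
    using that zdvd_not_zless[of c "2 ^ h"] dvd_trans[of "2 ^ h" "2 ^ e" c] by force
  then have "{c \<in> Zpow2 h. 2 ^ e dvd c} = {0}" by auto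
  then show ?thesis using False by simp
qed

lemma finite_effective_coeffs: "finite (effective_coeffs \<rho> k h)"
  by (rule finite_subset[OF effective_coeffs_subset]) (auto intro: finite_PiE)

lemma finite_\<F>: "h \<ge> 1 \<Longrightarrow> finite (\<F> \<rho> k h)"
  by (simp add: \<F>_eq_image finite_effective_coeffs)

text \<open>Coefficients are chosen independently: the residues modulo \<open>2 ^ h\<close>
  divisible by the power required in degree \<open>w\<close> are counted, and
  \<open>k choose w\<close> monomials share that degree.\<close>

lemma card_\<F>:
  assumes "h \<ge> 1"
  shows "card (\<F> \<rho> k h) = 2 ^ (\<Sum>w\<le>k. (h - nat (int w - \<rho>)) * (k choose w))"
proof -
  have "card (\<F> \<rho> k h) = card (effective_coeffs \<rho> k h)"
    unfolding \<F>_eq_image[OF assms]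
    by (intro card_image inj_on_subset[OF anf_eval_inj effective_coeffs_subset])
  also have "\<dots> = (\<Prod>i\<in>cube k. 2 ^ (h - nat (int (\<Sum>\<alpha><k. i \<alpha>) - \<rho>)))"
    unfolding effective_coeffs_def by (simp add: card_PiE card_multiples_power2 del: of_nat_sum atLeastLessThan_iff)
  also have "\<dots> = 2 ^ (\<Sum>i\<in>cube k. h - nat (int (\<Sum>\<alpha><k. i \<alpha>) - \<rho>))"
    by (simp add: power_sum)
  also have "(\<Sum>i\<in>cube k. h - nat (int (\<Sum>\<alpha><k. i \<alpha>) - \<rho>)) =
      (\<Sum>S\<in>Pow {..<k}. h - nat (int (card S) - \<rho>))"
    unfolding sum_cube_point by (intro sum.cong) (auto simp: sum_point simp del: of_nat_sum)
  also have "\<dots> = (\<Sum>w\<le>k. \<Sum>S\<in>{S \<in> Pow {..<k}. card S = w}. h - nat (int (card S) - \<rho>))"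
  proof (rule sum.group[symmetric])
    show "card ` Pow {..<k} \<subseteq> {..k}" using card_mono[of "{..<k}"] by fastforce
  qed auto
  also have "\<dots> = (\<Sum>w\<le>k. (h - nat (int w - \<rho>)) * (k choose w))"
    using n_subsets[of "{..<k}"] by (intro sum.cong) auto
  finally show ?thesis .
qed

lemma effective_count_eq:
  assumes "\<rho> \<ge> -1"
  shows "(\<Sum>w\<le>k. (h - nat (int w - \<rho>)) * (k choose w)) =
    (\<Sum>i\<in>{0..\<rho>}. h * (k choose nat i))
      + (\<Sum>i\<in>{1..int h - 1}. nat (int h - i) * (k choose nat (\<rho> + i)))"
proof -
  \<comment> \<open>Integer indices make the range \<open>{0..\<rho>}\<close> empty when
    \<open>\<rho> = -1\<close>.\<close>
  define b where "b = (\<lambda>w. (h - nat (w - \<rho>)) * (k choose nat w))"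
  \<comment> \<open>\<open>N\<close> bounds both index ranges. Terms with \<open>w > k\<close>
    vanish by the binomial, those with \<open>w \<ge> \<rho> + h\<close> by truncated subtraction;
    \<open>\<rho> \<ge> -1\<close> keeps the second range nonnegative.\<close>
  define N where "N = max (int k) (\<rho> + int h)"
  have "(\<Sum>w\<le>k. (h - nat (int w - \<rho>)) * (k choose w)) = (\<Sum>w\<in>{0..int k}. b w)"
    by (rule sum.reindex_bij_witness[of _ nat int]) (auto simp: b_def)
  also have "\<dots> = (\<Sum>w\<in>{0..N}. b w)"
    by (rule sum.mono_neutral_left) (auto simp: N_def b_def)
  also have "\<dots> = (\<Sum>w\<in>{0..\<rho>} \<union> {\<rho>+1..\<rho> + int h - 1}. b w)"
    using assms by (intro sum.mono_neutral_right) (auto simp: N_def b_def)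
  also have "\<dots> = (\<Sum>w\<in>{0..\<rho>}. b w) + (\<Sum>w\<in>{\<rho>+1..\<rho> + int h - 1}. b w)"
    by (intro sum.union_disjoint) auto
  also have "(\<Sum>w\<in>{0..\<rho>}. b w) = (\<Sum>i\<in>{0..\<rho>}. h * (k choose nat i))"
    by (intro sum.cong) (auto simp: b_def)
  also have "(\<Sum>w\<in>{\<rho>+1..\<rho> + int h - 1}. b w) =
      (\<Sum>i\<in>{1..int h - 1}. nat (int h - i) * (k choose nat (\<rho> + i)))"
    by (rule sum.reindex_bij_witness[of _ "\<lambda>i. \<rho> + i" "\<lambda>w. w - \<rho>"])
       (auto simp: b_def nat_diff_distrib')
  finally show ?thesis .
qed

lemma log_card_\<F>:
  assumes "h \<ge> 1" "\<rho> \<ge> -1"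
  shows "log 2 (real (card (\<F> \<rho> k h))) =
    real ((\<Sum>i\<in>{0..\<rho>}. h * (k choose nat i))
      + (\<Sum>i\<in>{1..int h - 1}. nat (int h - i) * (k choose nat (\<rho> + i))))"
  unfolding card_\<F>[OF assms(1)] effective_count_eq[OF assms(2)] by (simp add: log_nat_power)

text \<open>The residues of the normal form, read as integers, satisfy the divisibility conditions,
  and reduction is postponed to the value. Sums and products can then be formed over the
  integers.\<close>

lemma \<F>_effective_poly:
  assumes "f \<in> \<F> \<rho> k h" "h \<ge> 1"
  obtains P where "P \<in> effective_polys \<rho> k" "\<And>x. x \<in> cube k \<Longrightarrow> f x = P x mod 2 ^ h"
proof -
  obtain c where c: "c \<in> effective_coeffs \<rho> k h" "f = anf_eval k h c"
    using assms by (auto simp: \<F>_eq_image)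
  define P where "P = (\<lambda>x. \<Sum>S\<in>Pow {..<k}. c (point k S) * int (\<Prod>\<alpha>\<in>S. x \<alpha>))"
  have "P \<in> effective_polys \<rho> k"
    unfolding P_def
  proof (intro effective_polys_sum effective_polys_monomial)
    fix S assume S: "S \<in> Pow {..<k}"
    show "2 ^ nat (int (card S) - \<rho>) dvd c (point k S)"
      using PiE_mem[OF c(1)[unfolded effective_coeffs_def], of "point k S"] S
      by (simp add: sum_point del: of_nat_sum)
  qed auto
  moreover have "f x = P x mod 2 ^ h" if "x \<in> cube k" for x
  proof -
    have "(\<Sum>i\<in>cube k. c i * int (\<Prod>\<alpha><k. x \<alpha> ^ i \<alpha>)) = P x"
      unfolding sum_cube_point P_def
      by (intro sum.cong) (auto simp: prod_power_point simp del: of_nat_prod)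
    then show ?thesis using that by (simp add: c(2) anf_eval_def)
  qed
  ultimately show thesis by (rule that)
qed

lemma zero_in_\<F>:
  assumes "h \<ge> 1" shows "(\<lambda>x\<in>cube k. 0) \<in> \<F> \<rho> k h"
proof -
  have "(\<lambda>x\<in>cube k. 0) = anf_eval k h (\<lambda>i\<in>cube k. 0)" by (auto simp: anf_eval_def)
  moreover have "(\<lambda>i\<in>cube k. 0) \<in> effective_coeffs \<rho> k h" by (auto simp: effective_coeffs_def)
  ultimately show ?thesis using assms by (simp add: \<F>_eq_image)
qed

text \<open>The normal form has the single coefficient 1, on which the exponent
  \<open>card S - card S = 0\<close> imposes no divisibility.\<close>

lemma monomial_in_\<F>:
  assumes "h \<ge> 1" "S \<subseteq> {..<k}"
  shows "(\<lambda>x\<in>cube k. int (\<Prod>\<alpha>\<in>S. x \<alpha>)) \<in> \<F> (int (card S)) k h"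
proof -
  let ?c = "\<lambda>i\<in>cube k. if i = point k S then 1 else (0::int)"
  have "anf_eval k h ?c x = (\<lambda>x\<in>cube k. int (\<Prod>\<alpha>\<in>S. x \<alpha>)) x" for x
  proof (cases "x \<in> cube k")
    case True
    then obtain X where X: "X \<subseteq> {..<k}" "x = point k X" by (rule cube_pointE)
    have "(\<Sum>i\<in>cube k. ?c i * int (\<Prod>\<alpha><k. x \<alpha> ^ i \<alpha>)) =
       (\<Sum>i\<in>cube k. if i = point k S then int (\<Prod>\<alpha><k. x \<alpha> ^ i \<alpha>) else 0)"
      by (intro sum.cong) auto
    also have "\<dots> = int (\<Prod>\<alpha>\<in>S. x \<alpha>)"
      using assms(2) by (simp add: prod_power_point del: of_nat_prod)
    finally have "anf_eval k h ?c x = int (\<Prod>\<alpha>\<in>S. x \<alpha>) mod 2 ^ h"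
      using True by (simp add: anf_eval_def del: of_nat_prod)
    moreover have "int (\<Prod>\<alpha>\<in>S. x \<alpha>) \<in> {0, 1}"
      using assms(2) by (simp add: X prod_point del: of_nat_prod)
    moreover have "(1::int) < 2 ^ h" using assms(1) by (simp add: one_less_power)
    ultimately show ?thesis using True by (metis (no_types, lifting) insertE mod_pos_pos_trivial
      mod_0 restrict_apply' singletonD zero_le_one)
  qed (simp add: anf_eval_def)
  then have "anf_eval k h ?c = (\<lambda>x\<in>cube k. int (\<Prod>\<alpha>\<in>S. x \<alpha>))" by (rule ext)
  moreover have "?c \<in> effective_coeffs (int (card S)) k h"
    using assms by (auto simp: effective_coeffs_def sum_point one_less_power simp del: of_nat_sum)
  ultimately show ?thesis using assms(1) by (metis \<F>_eq_image imageI)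
qed

section \<open>Splitting off the last coordinates\<close>

text \<open>The free coordinates come first and the \<open>k\<close> coordinates that select a
  summand of \<open>\<R>\<close> last, in agreement with \<open>last_coords\<close> for
  \<open>m = n + k\<close>.\<close>

definition join_coords :: "nat \<Rightarrow> nat \<Rightarrow> (nat \<Rightarrow> nat) \<Rightarrow> (nat \<Rightarrow> nat) \<Rightarrow> nat \<Rightarrow> nat" where
  "join_coords n k y d = (\<lambda>\<alpha>\<in>{..<n + k}. if \<alpha> < n then y \<alpha> else d (\<alpha> - n))"

lemma join_coords_in_cube [simp]:
  "y \<in> cube n \<Longrightarrow> d \<in> cube k \<Longrightarrow> join_coords n k y d \<in> cube (n + k)"
  by (auto simp: join_coords_def cube_def PiE_def Pi_def)

lemma join_coords_first: "i < n \<Longrightarrow> join_coords n k y d i = y i"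
  by (simp add: join_coords_def)

lemma last_coords_join_coords:
  assumes "d \<in> cube k" shows "last_coords k (n + k) (join_coords n k y d) = d"
proof
  fix j show "last_coords k (n + k) (join_coords n k y d) j = d j"
    using assms
    by (cases "j < k") (auto simp: last_coords_def join_coords_def cube_def PiE_def extensional_def)
qed

lemma bij_betw_join_coords:
  "bij_betw (\<lambda>(d, y). join_coords n k y d) (cube k \<times> cube n) (cube (n + k))"
proof (rule bij_betw_byWitness[where f' = "\<lambda>x. (last_coords k (n + k) x, restrict x {..<n})"])
  have "restrict (join_coords n k y d) {..<n} = y" if "y \<in> cube n" for y d
  proof
    fix i show "restrict (join_coords n k y d) {..<n} i = y i"
      using that by (cases "i < n") (auto simp: join_coords_def cube_def PiE_def extensional_def)
  qed
  then show "\<forall>p\<in>cube k \<times> cube n. (\<lambda>x. (last_coords k (n + k) x, restrict x {..<n}))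
      ((\<lambda>(d, y). join_coords n k y d) p) = p"
    by (auto simp: last_coords_join_coords)
  have "join_coords n k (restrict x {..<n}) (last_coords k (n + k) x) = x"
    if "x \<in> cube (n + k)" for x
  proof
    fix i show "join_coords n k (restrict x {..<n}) (last_coords k (n + k) x) i = x i"
      using that by (cases "i < n + k")
        (auto simp: join_coords_def last_coords_def cube_def PiE_def extensional_def)
  qed
  then show "\<forall>x\<in>cube (n + k). (\<lambda>(d, y). join_coords n k y d)
      (last_coords k (n + k) x, restrict x {..<n}) = x"
    by auto
  show "(\<lambda>(d, y). join_coords n k y d) ` (cube k \<times> cube n) \<subseteq> cube (n + k)" by auto
  show "(\<lambda>x. (last_coords k (n + k) x, restrict x {..<n})) ` cube (n + k) \<subseteq> cube k \<times> cube n"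
  proof -
    have "restrict x {..<n} \<in> cube n" if "x \<in> cube (n + k)" for x
      unfolding cube_def restrict_PiE_iff
    proof
      fix i assume "i \<in> {..<n}"
      then show "x i \<in> {0, 1}" using PiE_mem[OF that[unfolded cube_def], of i] by simp
    qed
    moreover have "last_coords k (n + k) x \<in> cube k" if "x \<in> cube (n + k)" for x
      using that by (rule last_coords_in_cube) simp
    ultimately show ?thesis by blast
  qed
qed

lemma sum_cube_join_coords:
  "(\<Sum>x\<in>cube (n + k). f x) = (\<Sum>d\<in>cube k. \<Sum>y\<in>cube n. f (join_coords n k y d))"
  using sum.reindex_bij_betw[OF bij_betw_join_coords[of n k], of f]
  by (simp add: sum.cartesian_product case_prod_beta)

section \<open>The linear code\<close>

text \<open>Neither reduction nor membership in \<open>\<F>\<close> is built in, so integer lifts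
  and differences of code functions again have this form.\<close>

definition code_function ::
  "nat \<Rightarrow> nat \<Rightarrow> (nat \<Rightarrow> (nat \<Rightarrow> nat) \<Rightarrow> int) \<Rightarrow> ((nat \<Rightarrow> nat) \<Rightarrow> int) \<Rightarrow> (nat \<Rightarrow> nat) \<Rightarrow> int"
where
  "code_function k m gs g x =
     (\<Sum>i<m - k. int (x i) * gs i (last_coords k m x)) + g (last_coords k m x)"

lemma \<A>_eq:
  "\<A> k r m h = {assoc_word m (\<lambda>x. code_function k m gs g x mod 2 ^ h)
     | gs g. (\<forall>i<m - k. gs i \<in> \<F> (int r - 1) k h) \<and> g \<in> \<F> (int r) k h}"
  unfolding \<A>_def code_function_def ..

text \<open>Restricting \<open>gs\<close> to its index range fixes its values elsewhere, which
  presents the code as the image of a product whose size is known.\<close>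

lemma \<A>_eq_image:
  "\<A> k r m h = (\<lambda>(gs, g). assoc_word m (\<lambda>x. code_function k m gs g x mod 2 ^ h)) `
     (({..<m - k} \<rightarrow>\<^sub>E \<F> (int r - 1) k h) \<times> \<F> (int r) k h)" (is "_ = ?R")
proof (intro equalityI subsetI)
  fix c assume "c \<in> \<A> k r m h"
  then obtain gs g where c: "c = assoc_word m (\<lambda>x. code_function k m gs g x mod 2 ^ h)"
    "\<forall>i<m - k. gs i \<in> \<F> (int r - 1) k h" "g \<in> \<F> (int r) k h"
    by (auto simp: \<A>_eq)
  have "code_function k m (restrict gs {..<m - k}) g = code_function k m gs g"
    by (auto simp: code_function_def)
  then show "c \<in> ?R" using c
    by (intro image_eqI[of _ _ "(restrict gs {..<m - k}, g)"]) auto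
qed (auto simp: \<A>_eq)

section \<open>Injectivity of the encoding and size of the code\<close>

lemma \<F>_value: "f \<in> \<F> \<rho> k h \<Longrightarrow> y \<in> cube k \<Longrightarrow> f y \<in> Zpow2 h"
  by (auto simp: \<F>_def gen_boolean_functions_def dest: PiE_mem)

lemma \<F>_ext:
  assumes "f \<in> \<F> \<rho> k h" "g \<in> \<F> \<rho>' k h" "\<And>y. y \<in> cube k \<Longrightarrow> f y = g y"
  shows "f = g"
  using assms unfolding \<F>_def gen_boolean_functions_def
  by (intro PiE_ext[where k = "cube k" and s = "\<lambda>_. Zpow2 h"]) auto

lemma mod_power2_inj: "a \<in> Zpow2 h \<Longrightarrow> b \<in> Zpow2 h \<Longrightarrow> a mod 2 ^ h = b mod 2 ^ h \<Longrightarrow> a = b"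
  by simp

text \<open>The data can be read off the values: first coordinates all 0 give \<open>g\<close>, and
  the unit vector at \<open>i\<close> gives \<open>gs i + g\<close>.\<close>

lemma inj_on_encode:
  assumes "k \<le> m"
  shows "inj_on (\<lambda>(gs, g). assoc_word m (\<lambda>x. code_function k m gs g x mod 2 ^ h))
     (({..<m - k} \<rightarrow>\<^sub>E \<F> \<rho> k h) \<times> \<F> \<rho>' k h)"
proof (rule inj_onI, clarify)
  fix gs g gs' g'
  assume mem: "gs \<in> {..<m - k} \<rightarrow>\<^sub>E \<F> \<rho> k h" "g \<in> \<F> \<rho>' k h"
    "gs' \<in> {..<m - k} \<rightarrow>\<^sub>E \<F> \<rho> k h" "g' \<in> \<F> \<rho>' k h"
    and eq: "assoc_word m (\<lambda>x. code_function k m gs g x mod 2 ^ h) =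
      assoc_word m (\<lambda>x. code_function k m gs' g' x mod 2 ^ h)"
  define n where "n = m - k"
  have m: "m = n + k" using assms by (simp add: n_def)
  have gs_mem: "gs i \<in> \<F> \<rho> k h" "gs' i \<in> \<F> \<rho> k h" if "i < n" for i
    using PiE_mem[OF mem(1), of i] PiE_mem[OF mem(3), of i] that by (simp_all add: n_def)
  have val: "((\<Sum>i<n. int (z i) * gs i y) + g y) mod 2 ^ h =
      ((\<Sum>i<n. int (z i) * gs' i y) + g' y) mod 2 ^ h"
    if "z \<in> cube n" "y \<in> cube k" for z y
  proof -
    have "join_coords n k z y \<in> cube m" using that by (simp add: m)
    from assoc_word_eqD[OF eq this] show ?thesis
      using that unfolding code_function_def m
      by (simp add: last_coords_join_coords join_coords_first)
  qed
  have sel: "(\<Sum>i<n. int (point n S i) * f i) = (\<Sum>i\<in>{..<n} \<inter> S. f i)" for S and f :: "nat \<Rightarrow> int"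
    by (subst sum.inter_restrict) (auto simp: point_def intro!: sum.cong)
  have g: "g y = g' y" if y: "y \<in> cube k" for y
  proof (rule mod_power2_inj)
    show "g y \<in> Zpow2 h" using mem(2) y by (rule \<F>_value)
    show "g' y \<in> Zpow2 h" using mem(4) y by (rule \<F>_value)
    show "g y mod 2 ^ h = g' y mod 2 ^ h"
      using val[OF point_in_cube[of n "{}"] y] unfolding sel by simp
  qed
  have "gs i y = gs' i y" if y: "y \<in> cube k" and i: "i < n" for i y
  proof -
    have "{..<n} \<inter> {i} = {i}" using i by auto
    then have "(gs i y + g y) mod 2 ^ h = (gs' i y + g y) mod 2 ^ h"
      using val[OF point_in_cube[of n "{i}"] y] g[OF y] unfolding sel by simp
    then have "gs i y mod 2 ^ h = gs' i y mod 2 ^ h" by (simp add: mod_eq_dvd_iff)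
    with \<F>_value[OF gs_mem(1)[OF i] y] \<F>_value[OF gs_mem(2)[OF i] y] show ?thesis by simp
  qed
  then have "gs i = gs' i" if "i < n" for i
    using \<F>_ext[OF gs_mem(1)[OF that] gs_mem(2)[OF that]] that by blast
  then have "gs = gs'" by (intro PiE_ext[OF mem(1) mem(3)]) (auto simp: n_def)
  moreover have "g = g'" using \<F>_ext[OF mem(2,4)] g by blast
  ultimately show "gs = gs' \<and> g = g'" by simp
qed

lemma card_\<A>:
  assumes "k \<le> m"
  shows "card (\<A> k r m h) = card (\<F> (int r - 1) k h) ^ (m - k) * card (\<F> (int r) k h)"
  unfolding \<A>_eq_image card_image[OF inj_on_encode[OF assms]]
  by (simp add: card_cartesian_product card_PiE)

lemma finite_\<A>: "h \<ge> 1 \<Longrightarrow> finite (\<A> k r m h)"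
  unfolding \<A>_eq_image by (intro finite_imageI finite_cartesian_product finite_PiE finite_\<F>) auto

lemma log_card_\<A>:
  assumes "k \<le> m" "h \<ge> 1"
  shows "log 2 (real (card (\<A> k r m h))) =
    real (m - k) * log 2 (real (card (\<F> (int r - 1) k h))) + log 2 (real (card (\<F> (int r) k h)))"
  by (simp add: card_\<A>[OF assms(1)] card_\<F>[OF assms(2)] log_mult log_nat_power)

text \<open>Each \<open>gs i\<close> has bound \<open>r - 1\<close> and gains one from the factor
  \<open>x i\<close>, so all terms of the code function meet the common bound
  \<open>r\<close>.\<close>

lemma \<A>_effective_poly:
  assumes "c \<in> \<A> k r m h" "k \<le> m" "h \<ge> 1"
  obtains P where "P \<in> effective_polys (int r) m" "c = assoc_word m (\<lambda>x. P x mod 2 ^ h)"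
proof -
  from assms(1) obtain gs g where c: "c = assoc_word m (\<lambda>x. code_function k m gs g x mod 2 ^ h)"
    "\<forall>i<m - k. gs i \<in> \<F> (int r - 1) k h" "g \<in> \<F> (int r) k h"
    by (auto simp: \<A>_eq)
  have "\<forall>i<m - k. \<exists>P \<in> effective_polys (int r - 1) k. \<forall>x\<in>cube k. gs i x = P x mod 2 ^ h"
    using c(2) \<F>_effective_poly[OF _ assms(3)] by metis
  then obtain Ps where Ps: "\<And>i. i < m - k \<Longrightarrow> Ps i \<in> effective_polys (int r - 1) k"
    "\<And>i x. i < m - k \<Longrightarrow> x \<in> cube k \<Longrightarrow> gs i x = Ps i x mod 2 ^ h"
    by metis
  obtain Q where Q: "Q \<in> effective_polys (int r) k" "\<And>x. x \<in> cube k \<Longrightarrow> g x = Q x mod 2 ^ h"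
    using \<F>_effective_poly[OF c(3) assms(3)] by metis
  have "(\<lambda>x. int (x i) * Ps i (last_coords k m x)) \<in> effective_polys (int r) m" if "i < m - k" for i
    using effective_polys_mult_var[OF _ effective_polys_last_coords[OF Ps(1)[OF that] assms(2)], of i]
      that by simp
  then have "(\<lambda>x. code_function k m Ps Q x) \<in> effective_polys (int r) m"
    unfolding code_function_def
    using effective_polys_last_coords[OF Q(1) assms(2)]
    by (intro effective_polys_add effective_polys_sum) auto
  moreover have "c = assoc_word m (\<lambda>x. code_function k m Ps Q x mod 2 ^ h)"
    unfolding c(1)
  proof (rule assoc_word_cong)
    fix x assume "x \<in> cube m"
    then have d: "last_coords k m x \<in> cube k" (is "?d \<in> _") using assms(2) by (rule last_coords_in_cube)
    have "(\<Sum>i<m - k. int (x i) * gs i ?d) mod 2 ^ h = (\<Sum>i<m - k. int (x i) * gs i ?d mod 2 ^ h) mod 2 ^ h"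
      by (rule mod_sum_eq[symmetric])
    also have "\<dots> = (\<Sum>i<m - k. int (x i) * Ps i ?d mod 2 ^ h) mod 2 ^ h"
    proof -
      have "int (x i) * gs i ?d mod 2 ^ h = int (x i) * Ps i ?d mod 2 ^ h" if "i < m - k" for i
        unfolding Ps(2)[OF that d] by (rule mod_mult_right_eq)
      then show ?thesis by simp
    qed
    also have "\<dots> = (\<Sum>i<m - k. int (x i) * Ps i ?d) mod 2 ^ h" by (rule mod_sum_eq)
    finally show "code_function k m gs g x mod 2 ^ h = code_function k m Ps Q x mod 2 ^ h"
      unfolding code_function_def by (intro mod_add_cong) (auto simp: Q(2)[OF d])
  qed
  ultimately show thesis by (rule that)
qed

lemma zero_in_\<A>:
  assumes "h \<ge> 1" "k \<le> m" shows "assoc_word m (\<lambda>x. 0) \<in> \<A> k r m h"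
proof -
  let ?z = "\<lambda>x\<in>cube k. 0 :: int"
  have "assoc_word m (\<lambda>x. code_function k m (\<lambda>_. ?z) ?z x mod 2 ^ h) \<in> \<A> k r m h"
    unfolding \<A>_eq using zero_in_\<F>[OF assms(1)] by blast
  also have "assoc_word m (\<lambda>x. code_function k m (\<lambda>_. ?z) ?z x mod 2 ^ h) = assoc_word m (\<lambda>x. 0)"
    using last_coords_in_cube[OF binary_digits_in_cube assms(2)]
    by (auto simp: assoc_word_def code_function_def)
  finally show ?thesis .
qed

text \<open>A squarefree monomial of degree \<open>r\<close> equals 1 on exactly
  \<open>2 ^ (m - r)\<close> points and 0 elsewhere; it will attain the minimum distance.\<close>

lemma monomial_in_\<A>:
  assumes "h \<ge> 1" "k < m" "r \<le> k + 1"
  obtains S where "S \<subseteq> {..<m}" "card S = r"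
    "assoc_word m (\<lambda>x. int (\<Prod>\<alpha>\<in>S. x \<alpha>)) \<in> \<A> k r m h"
proof -
  let ?z = "\<lambda>x\<in>cube k. 0 :: int"
  let ?f = "\<lambda>t. \<lambda>x\<in>cube k. int (\<Prod>\<alpha><t. x \<alpha>)"
  have one: "(1::int) < 2 ^ h" using assms(1) by (simp add: one_less_power)
  have prod_last: "(\<Prod>\<alpha><t. last_coords k m x \<alpha>) = (\<Prod>\<alpha>\<in>(+) (m - k) ` {..<t}. x \<alpha>)" if "t \<le> k" for t x
    using that by (subst prod.reindex) (auto simp: last_coords_def intro!: prod.cong)
  have mod_prod: "int (\<Prod>\<alpha>\<in>S. x \<alpha>) mod 2 ^ h = int (\<Prod>\<alpha>\<in>S. x \<alpha>)"
    if "S \<subseteq> {..<m}" "x \<in> cube m" for S x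
  proof -
    obtain X where X: "X \<subseteq> {..<m}" "x = point m X" using \<open>x \<in> cube m\<close> by (rule cube_pointE)
    have "int (\<Prod>\<alpha>\<in>S. x \<alpha>) \<in> {0, 1}"
      using that(1) by (simp add: X prod_point del: of_nat_prod)
    then show ?thesis using one by (metis insertE mod_pos_pos_trivial mod_0 singletonD zero_le_one)
  qed
  show thesis
  proof (cases "r \<le> k")
    case True
    \<comment> \<open>Degree at most \<open>k\<close> fits into \<open>g\<close> alone, using the
      first \<open>r\<close> of the last \<open>k\<close> variables.\<close>
    let ?S = "(+) (m - k) ` {..<r}"
    have S: "?S \<subseteq> {..<m}" using True assms by auto
    have f: "?f r \<in> \<F> (int r) k h" using monomial_in_\<F>[OF assms(1), of "{..<r}" k] True by auto
    have "assoc_word m (\<lambda>x. code_function k m (\<lambda>_. ?z) (?f r) x mod 2 ^ h) \<in> \<A> k r m h"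
      unfolding \<A>_eq using zero_in_\<F>[OF assms(1)] f by blast
    also have "assoc_word m (\<lambda>x. code_function k m (\<lambda>_. ?z) (?f r) x mod 2 ^ h) =
        assoc_word m (\<lambda>x. int (\<Prod>\<alpha>\<in>?S. x \<alpha>))"
    proof (rule assoc_word_cong)
      fix x assume x: "x \<in> cube m"
      then have "last_coords k m x \<in> cube k" using last_coords_in_cube[of x m k] assms(2) by simp
      then have "code_function k m (\<lambda>_. ?z) (?f r) x = int (\<Prod>\<alpha><r. last_coords k m x \<alpha>)"
        by (simp add: code_function_def)
      then show "code_function k m (\<lambda>_. ?z) (?f r) x mod 2 ^ h = int (\<Prod>\<alpha>\<in>?S. x \<alpha>)"
        unfolding prod_last[OF True] using mod_prod[OF S x] by argo
    qed
    finally show thesis using S by (intro that[of ?S]) (auto simp: card_image)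
  next
    case False
    then have r: "r = k + 1" using assms by simp
    \<comment> \<open>The extra degree comes from a free variable: \<open>x 0\<close>, available
      since \<open>k < m\<close>, times all of the last \<open>k\<close> variables.\<close>
    let ?S = "insert 0 ((+) (m - k) ` {..<k})"
    let ?gs = "\<lambda>i. if i = 0 then ?f k else ?z"
    have S: "?S \<subseteq> {..<m}" using assms by auto
    have f: "?f k \<in> \<F> (int r - 1) k h" using monomial_in_\<F>[OF assms(1), of "{..<k}" k] r by auto
    have "assoc_word m (\<lambda>x. code_function k m ?gs ?z x mod 2 ^ h) \<in> \<A> k r m h"
      unfolding \<A>_eq mem_Collect_eq using zero_in_\<F>[OF assms(1)] f
      by (intro exI[of _ ?gs] exI[of _ ?z]) auto
    also have "assoc_word m (\<lambda>x. code_function k m ?gs ?z x mod 2 ^ h) =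
        assoc_word m (\<lambda>x. int (\<Prod>\<alpha>\<in>?S. x \<alpha>))"
    proof (rule assoc_word_cong)
      fix x assume x: "x \<in> cube m"
      then have d: "last_coords k m x \<in> cube k" using last_coords_in_cube[of x m k] assms(2) by simp
      have "code_function k m ?gs ?z x =
          (\<Sum>i<m - k. if i = 0 then int (x i) * ?f k (last_coords k m x) else 0)"
      proof -
        have "(\<Sum>i<m - k. int (x i) * ?gs i (last_coords k m x)) =
            (\<Sum>i<m - k. if i = 0 then int (x i) * ?f k (last_coords k m x) else 0)"
          using d by (intro sum.cong) auto
        then show ?thesis using d by (simp add: code_function_def)
      qed
      also have "\<dots> = int (x 0) * ?f k (last_coords k m x)" using assms(2) by simp
      also have "\<dots> = int (x 0 * (\<Prod>\<alpha><k. last_coords k m x \<alpha>))" using d by simp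
      also have "x 0 * (\<Prod>\<alpha><k. last_coords k m x \<alpha>) = (\<Prod>\<alpha>\<in>?S. x \<alpha>)"
        unfolding prod_last[OF order.refl] using assms(2) by (subst prod.insert) auto
      finally show "code_function k m ?gs ?z x mod 2 ^ h = int (\<Prod>\<alpha>\<in>?S. x \<alpha>)"
        using mod_prod[OF S x] by argo
    qed
    finally have "assoc_word m (\<lambda>x. int (\<Prod>\<alpha>\<in>?S. x \<alpha>)) \<in> \<A> k r m h" .
    moreover have "card ((+) (m - k) ` {..<k}) = k" by (subst card_image) auto
    then have "card ?S = r" using assms(2) r by (subst card_insert_disjoint) auto
    ultimately show thesis using S by (intro that[of ?S])
  qed
qed

section \<open>Distances\<close>

lemma sum_assoc_word: "(\<Sum>i<2 ^ m. \<phi> (assoc_word m f i)) = (\<Sum>x\<in>cube m. \<phi> (f x))"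
  unfolding sum_word[symmetric] by (intro sum.cong) (auto simp: assoc_word_def)

text \<open>\<open>\<phi>\<close> stays abstract so that the Lee and Euclidean cases share the
  bound. The entries over \<open>T\<close> are nonzero multiples of \<open>2 ^ j\<close> and suffice
  alone; all others add nonnegative weight.\<close>

lemma effective_poly_weight_ge:
  fixes \<phi> :: "int \<Rightarrow> real" and r :: nat
  assumes P: "P \<in> effective_polys (int r) m" and nz: "\<exists>x\<in>cube m. \<not> 2 ^ h dvd P x"
    and nonneg: "\<And>a. a \<in> Zpow2 h \<Longrightarrow> 0 \<le> \<phi> a" and w: "0 \<le> w"
    and ge: "\<And>a j. j < h \<Longrightarrow> a \<in> Zpow2 h \<Longrightarrow> a \<noteq> 0 \<Longrightarrow> 2 ^ j dvd a \<Longrightarrow> 2 ^ j * w \<le> \<phi> a"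
  shows "2 ^ (m - r) * w \<le> (\<Sum>x\<in>cube m. \<phi> (P x mod 2 ^ h))"
proof -
  obtain j T where T: "j < h" "T \<subseteq> cube m" "2 ^ (m - r) \<le> card T * 2 ^ j"
    "\<And>x. x \<in> T \<Longrightarrow> \<not> 2 ^ Suc j dvd P x" "\<And>x. x \<in> cube m \<Longrightarrow> 2 ^ j dvd P x"
    using effective_poly_many_nonzeros[OF P nz] by metis
  have "real (2 ^ (m - r)) * w \<le> real (card T * 2 ^ j) * w"
    using T(3) w by (intro mult_right_mono) (simp_all only: of_nat_le_iff)
  also have "\<dots> = (\<Sum>x\<in>T. 2 ^ j * w)" by simp
  also have "\<dots> \<le> (\<Sum>x\<in>T. \<phi> (P x mod 2 ^ h))"
  proof (intro sum_mono ge T(1))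
    fix x assume x: "x \<in> T"
    have "(2::int) ^ j dvd 2 ^ h" using T(1) by (intro le_imp_power_dvd) simp
    then show "2 ^ j dvd P x mod 2 ^ h" using T(2,5) x by (simp add: dvd_mod subset_iff)
    have "(2::int) ^ Suc j dvd 2 ^ h" using T(1) by (intro le_imp_power_dvd) simp
    then show "P x mod 2 ^ h \<noteq> 0" using T(4)[OF x] dvd_trans by (metis dvd_eq_mod_eq_0)
  qed auto
  also have "\<dots> \<le> (\<Sum>x\<in>cube m. \<phi> (P x mod 2 ^ h))"
    using T(2) by (intro sum_mono2) (auto intro!: nonneg)
  finally show ?thesis by simp
qed

section \<open>Lee and Euclidean weights of multiples of a power of two\<close>

lemma multiple_power2_bounds:
  fixes a :: int
  assumes "a \<in> Zpow2 h" "a \<noteq> 0" "2 ^ j dvd a" "j < h"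
  shows "2 ^ j \<le> a" "a \<le> 2 ^ h - 2 ^ j"
proof -
  show "2 ^ j \<le> a" using assms by (intro zdvd_imp_le) auto
  \<comment> \<open>The distance to the modulus is again a positive multiple of
    \<open>2 ^ j\<close>.\<close>
  have "(2::int) ^ j dvd 2 ^ h - a"
    using assms by (intro dvd_diff le_imp_power_dvd) auto
  then have "2 ^ j \<le> 2 ^ h - a" using assms by (intro zdvd_imp_le) auto
  then show "a \<le> 2 ^ h - 2 ^ j" by simp
qed

lemma root_of_unity_powi: "root_of_unity h powi a = cis (2 * pi * real_of_int a / 2 ^ h)"
proof -
  have "root_of_unity h = cis (2 * pi / 2 ^ h)"
    by (simp add: root_of_unity_def cis_conv_exp mult_ac)
  then show ?thesis by (simp add: cis_power_int mult_ac)
qed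

text \<open>The chord from 1 to the point at angle \<open>2 * t\<close> has length twice the
  absolute value of \<open>sin t\<close>.\<close>

lemma sq_dist_root_of_unity:
  "(cmod (root_of_unity h powi a - 1))\<^sup>2 = 4 * (sin (pi * real_of_int a / 2 ^ h))\<^sup>2"
proof -
  define t where "t = pi * real_of_int a / 2 ^ h"
  have "(cmod (cis (2 * t) - 1))\<^sup>2 = (cos (2 * t) - 1)\<^sup>2 + (sin (2 * t))\<^sup>2"
    by (simp add: cmod_power2)
  also have "\<dots> = 2 - 2 * cos (2 * t)"
    using sin_cos_squared_add[of "2 * t"] by (simp add: power2_eq_square algebra_simps)
  also have "\<dots> = 4 * (sin t)\<^sup>2" by (simp add: cos_double_sin)
  finally show ?thesis by (simp add: root_of_unity_powi t_def mult.assoc)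
qed

text \<open>Doubling an angle multiplies its squared sine by four times its squared cosine, hence by
  at least 2 up to \<open>pi / 4\<close>; \<open>j < h\<close> keeps every angle that is doubled in
  that range.\<close>

lemma sin_power2_ge:
  "j < h \<Longrightarrow> 2 ^ j * (sin (pi / 2 ^ h))\<^sup>2 \<le> (sin (pi * 2 ^ j / 2 ^ h))\<^sup>2"
proof (induction j)
  case (Suc j)
  define t where "t = pi * 2 ^ j / 2 ^ h"
  have "(2::real) ^ (j + 2) \<le> 2 ^ h" using Suc.prems by (intro power_increasing) auto
  then have "4 * 2 ^ j \<le> (2::real) ^ h" by (simp add: power_add)
  then have t: "0 \<le> t" "t \<le> pi / 4" by (simp_all add: t_def field_simps)
  then have "cos (pi / 4) \<le> cos t" by (intro cos_monotone_0_pi_le) auto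
  then have "(cos (pi / 4))\<^sup>2 \<le> (cos t)\<^sup>2" by (intro power_mono) (auto simp: cos_45)
  then have "1 / 2 \<le> (cos t)\<^sup>2" by (simp add: cos_45 power_divide)
  then have "2 * (sin t)\<^sup>2 \<le> 4 * ((cos t)\<^sup>2 * (sin t)\<^sup>2)"
    using mult_right_mono[of "1 / 2" "(cos t)\<^sup>2" "(sin t)\<^sup>2"] by simp
  also have "\<dots> = (sin (2 * t))\<^sup>2" by (simp add: sin_double power_mult_distrib)
  finally have "2 * (sin t)\<^sup>2 \<le> (sin (2 * t))\<^sup>2" .
  moreover have "2 ^ j * (sin (pi / 2 ^ h))\<^sup>2 \<le> (sin t)\<^sup>2" using Suc by (simp add: t_def)
  ultimately show ?case by (simp add: t_def mult_ac)
qed simp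

text \<open>Sine increases up to \<open>pi / 2\<close> and is symmetric about it, so its minimum
  over the interval is at the endpoints.\<close>

lemma sin_ge_of_between:
  assumes "0 \<le> t" "t \<le> y" "y \<le> pi - t"
  shows "sin t \<le> sin y"
proof (cases "y \<le> pi / 2")
  case True
  then show ?thesis using assms by (intro sin_monotone_2pi_le) auto
next
  case False
  then have "sin t \<le> sin (pi - y)" using assms by (intro sin_monotone_2pi_le) auto
  then show ?thesis by simp
qed

text \<open>The angle \<open>pi * a / 2 ^ h\<close> lies between that of \<open>2 ^ j\<close> and
  its mirror image about \<open>pi / 2\<close>, so the worst case is \<open>a = 2 ^ j\<close>,
  settled by repeated doubling.\<close>

lemma sq_dist_root_of_unity_ge:
  assumes "j < h" "a \<in> Zpow2 h" "a \<noteq> 0" "2 ^ j dvd a"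
  shows "2 ^ j * (4 * (sin (pi / 2 ^ h))\<^sup>2) \<le> (cmod (root_of_unity h powi a - 1))\<^sup>2"
proof -
  have "real_of_int (2 ^ j) \<le> real_of_int a" "real_of_int a \<le> real_of_int (2 ^ h - 2 ^ j)"
    using multiple_power2_bounds[OF assms(2-4,1)] by (simp_all only: of_int_le_iff)
  then have a: "2 ^ j \<le> real_of_int a" "real_of_int a \<le> 2 ^ h - 2 ^ j" by simp_all
  have "0 \<le> pi * 2 ^ j / 2 ^ h" by simp
  moreover have "pi * 2 ^ j / 2 ^ h \<le> pi * real_of_int a / 2 ^ h"
    using a by (intro divide_right_mono mult_left_mono) auto
  moreover have "pi * real_of_int a / 2 ^ h \<le> pi * (2 ^ h - 2 ^ j) / 2 ^ h"
    using a by (intro divide_right_mono mult_left_mono) auto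
  then have "pi * real_of_int a / 2 ^ h \<le> pi - pi * 2 ^ j / 2 ^ h"
    by (simp add: diff_divide_distrib right_diff_distrib)
  ultimately have "sin (pi * 2 ^ j / 2 ^ h) \<le> sin (pi * real_of_int a / 2 ^ h)"
    by (rule sin_ge_of_between)
  moreover have "(2::real) ^ j \<le> 2 ^ h" using assms(1) by (intro power_increasing) auto
  then have "0 \<le> sin (pi * 2 ^ j / 2 ^ h)"
    by (intro sin_ge_zero) (auto simp: field_simps)
  ultimately have "(sin (pi * 2 ^ j / 2 ^ h))\<^sup>2 \<le> (sin (pi * real_of_int a / 2 ^ h))\<^sup>2"
    by (intro power_mono)
  then show ?thesis using sin_power2_ge[OF assms(1)] by (simp add: sq_dist_root_of_unity)
qed

lemma lee_ge:
  fixes a :: int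
  assumes "j < h" "a \<in> Zpow2 h" "a \<noteq> 0" "2 ^ j dvd a"
  shows "2 ^ j * 1 \<le> real_of_int (min a (2 ^ h - a))"
proof -
  have "2 ^ j \<le> min a (2 ^ h - a)" using multiple_power2_bounds[OF assms(2-4,1)] by simp
  then have "real_of_int (2 ^ j) \<le> real_of_int (min a (2 ^ h - a))" by (simp only: of_int_le_iff)
  then show ?thesis by simp
qed

section \<open>Minimum distance of a coset\<close>

lemma minimum_distance_eqI:
  assumes "finite C" "\<And>a b. a \<in> C \<Longrightarrow> b \<in> C \<Longrightarrow> a \<noteq> b \<Longrightarrow> d \<le> dst a b"
    "\<exists>a\<in>C. \<exists>b\<in>C. a \<noteq> b \<and> dst a b = d"
  shows "minimum_distance dst C = d"
  unfolding minimum_distance_def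
proof (rule Min_eqI)
  have "{dst a b | a b. a \<in> C \<and> b \<in> C \<and> a \<noteq> b} \<subseteq> (\<lambda>(a, b). dst a b) ` (C \<times> C)" by auto
  then show "finite {dst a b | a b. a \<in> C \<and> b \<in> C \<and> a \<noteq> b}"
    by (rule finite_subset) (simp add: assms(1))
qed (use assms in auto)

text \<open>The translation cancels in differences, so distances within a coset are distances within
  the code.\<close>

lemma word_diff_translate:
  "word_diff n h (word_add n h a b) (word_add n h a c) = word_diff n h b c"
proof
  fix i show "word_diff n h (word_add n h a b) (word_add n h a c) i = word_diff n h b c i"
    by (cases "i < n") (simp_all add: word_diff_def word_add_def mod_diff_eq)
qed

lemma word_diff_assoc_word:
  "word_diff (2 ^ m) h (assoc_word m (\<lambda>x. P x mod 2 ^ h)) (assoc_word m (\<lambda>x. Q x mod 2 ^ h)) =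
    assoc_word m (\<lambda>x. (P x - Q x) mod 2 ^ h)"
  by (auto simp: word_diff_def assoc_word_def mod_diff_eq)

lemma inj_word_add:
  assumes "A \<subseteq> words n h" shows "inj_on (word_add n h a) A"
proof (rule inj_onI)
  fix b c assume bc: "b \<in> A" "c \<in> A" "word_add n h a b = word_add n h a c"
  show "b = c"
  proof (rule PiE_ext)
    show b: "b \<in> {..<n} \<rightarrow>\<^sub>E Zpow2 h" and c: "c \<in> {..<n} \<rightarrow>\<^sub>E Zpow2 h"
      using bc assms by (auto simp: words_def)
    fix i assume i: "i \<in> {..<n}"
    have "(a i + b i) mod 2 ^ h = (a i + c i) mod 2 ^ h"
      using fun_cong[OF bc(3), of i] i by (simp add: word_add_def)
    then have "b i mod 2 ^ h = c i mod 2 ^ h" by (simp add: mod_eq_dvd_iff)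
    with PiE_mem[OF b i] PiE_mem[OF c i] show "b i = c i" by simp
  qed
qed

lemma \<A>_subset_words: "\<A> k r m h \<subseteq> words (2 ^ m) h"
proof
  fix c assume "c \<in> \<A> k r m h"
  then obtain f where "c = assoc_word m (\<lambda>x. f x mod 2 ^ h)" by (auto simp: \<A>_eq)
  then show "c \<in> words (2 ^ m) h" unfolding words_def assoc_word_def by simp
qed

lemma coset_card:
  assumes "is_coset (2 ^ m) h (\<A> k r m h) C"
  shows "card C = card (\<A> k r m h)"
  using assms card_image[OF inj_word_add[OF \<A>_subset_words]] by (auto simp: is_coset_def)

text \<open>The embedding \<open>conv\<close> into the reals covers the integer-valued Lee weight and the
  real-valued Euclidean weight at once.\<close>

lemma coset_minimum_distance:
  fixes \<phi> :: "int \<Rightarrow> real" and wt :: "(nat \<Rightarrow> int) \<Rightarrow> 'a :: linorder" and conv :: "'a \<Rightarrow> real"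
  assumes k: "k < m" "r \<le> k + 1" "h \<ge> 1" and C: "is_coset (2 ^ m) h (\<A> k r m h) C"
    and conv: "\<And>a b. conv a \<le> conv b \<longleftrightarrow> a \<le> b" "\<And>a. conv (wt a) = (\<Sum>i<2 ^ m. \<phi> (a i))"
    and d: "conv d = 2 ^ (m - r) * \<phi> 1"
    and zero: "\<phi> 0 = 0" and nonneg: "\<And>a. a \<in> Zpow2 h \<Longrightarrow> 0 \<le> \<phi> a"
    and ge: "\<And>a j. j < h \<Longrightarrow> a \<in> Zpow2 h \<Longrightarrow> a \<noteq> 0 \<Longrightarrow> 2 ^ j dvd a \<Longrightarrow> 2 ^ j * \<phi> 1 \<le> \<phi> a"
  shows "minimum_distance (\<lambda>a b. wt (word_diff (2 ^ m) h a b)) C = d"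
proof (rule minimum_distance_eqI)
  obtain a where a: "C = word_add (2 ^ m) h a ` \<A> k r m h" using C by (auto simp: is_coset_def)
  show "finite C" unfolding a using k by (simp add: finite_\<A>)
  have one: "(1::int) < 2 ^ h" using k(3) by (simp add: one_less_power)
  have conv_eq: "conv a = conv b \<longleftrightarrow> a = b" for a b using conv(1) by (metis order.antisym order.refl)
  show "d \<le> wt (word_diff (2 ^ m) h b c)" if bc: "b \<in> C" "c \<in> C" "b \<noteq> c" for b c
  proof -
    obtain b' c' where b': "b' \<in> \<A> k r m h" "b = word_add (2 ^ m) h a b'"
      and c': "c' \<in> \<A> k r m h" "c = word_add (2 ^ m) h a c'" using bc a by auto
    obtain P where P: "P \<in> effective_polys (int r) m" "b' = assoc_word m (\<lambda>x. P x mod 2 ^ h)"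
      using \<A>_effective_poly[OF b'(1)] k by auto
    obtain Q where Q: "Q \<in> effective_polys (int r) m" "c' = assoc_word m (\<lambda>x. Q x mod 2 ^ h)"
      using \<A>_effective_poly[OF c'(1)] k by auto
    \<comment> \<open>Distinct words differ somewhere, and there the integer polynomial
      \<open>P - Q\<close> is nonzero modulo \<open>2 ^ h\<close>.\<close>
    have "\<exists>x\<in>cube m. \<not> 2 ^ h dvd P x - Q x"
    proof (rule ccontr)
      assume "\<not> ?thesis"
      then have "P x mod 2 ^ h = Q x mod 2 ^ h" if "x \<in> cube m" for x
        using that by (simp add: mod_eq_dvd_iff)
      then have "b' = c'" unfolding P(2) Q(2)
        by (auto simp: assoc_word_def binary_digits_in_cube)
      then show False using b' c' bc by simp
    qed
    from effective_poly_weight_ge[OF effective_polys_diff[OF P(1) Q(1)] this nonneg _ ge]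
    have "2 ^ (m - r) * \<phi> 1 \<le> (\<Sum>x\<in>cube m. \<phi> ((P x - Q x) mod 2 ^ h))"
      using nonneg[of 1] one by simp
    also have "\<dots> = conv (wt (word_diff (2 ^ m) h b c))"
      unfolding b'(2) c'(2) word_diff_translate P(2) Q(2) word_diff_assoc_word conv(2)
      by (rule sum_assoc_word[symmetric])
    finally show ?thesis unfolding d[symmetric] conv(1) .
  qed
  \<comment> \<open>The bound is attained by the translates of the zero word and of a monomial of
    degree \<open>r\<close>.\<close>
  obtain S where S: "S \<subseteq> {..<m}" "card S = r"
    and mem: "assoc_word m (\<lambda>x. int (\<Prod>\<alpha>\<in>S. x \<alpha>)) \<in> \<A> k r m h" (is "?s \<in> _")
    using monomial_in_\<A>[OF k(3,1,2)] by metis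
  have mem0: "assoc_word m (\<lambda>x. 0) \<in> \<A> k r m h" (is "?o \<in> _") using zero_in_\<A> k by simp
  let ?b = "word_add (2 ^ m) h a ?s" and ?c = "word_add (2 ^ m) h a ?o"
  have finS: "finite S" using S(1) finite_subset by blast
  have "conv (wt (word_diff (2 ^ m) h ?b ?c)) = (\<Sum>i<2 ^ m. \<phi> (word_diff (2 ^ m) h ?s ?o i))"
    unfolding conv(2) word_diff_translate ..
  also have "\<dots> = (\<Sum>x\<in>cube m. \<phi> (int (\<Prod>\<alpha>\<in>S. x \<alpha>) mod 2 ^ h))"
    unfolding sum_word[symmetric]
    by (intro sum.cong) (auto simp: word_diff_def assoc_word_def simp del: of_nat_prod)
  \<comment> \<open>The monomial is 1 exactly at the supersets of \<open>S\<close>, of which there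
    are \<open>2 ^ (m - r)\<close>.\<close>
  also have "\<dots> = (\<Sum>X\<in>Pow {..<m}. if S \<subseteq> X then \<phi> 1 else 0)"
    unfolding sum_cube_point using k(3)
    by (intro sum.cong refl) (simp add: prod_point[OF S(1)] zero del: of_nat_prod)
  also have "\<dots> = real (card {X. S \<subseteq> X \<and> X \<subseteq> {..<m}}) * \<phi> 1"
  proof -
    have "{X \<in> Pow {..<m}. S \<subseteq> X} = {X. S \<subseteq> X \<and> X \<subseteq> {..<m}}" by auto
    moreover have "(\<Sum>X\<in>Pow {..<m}. if S \<subseteq> X then \<phi> 1 else 0) =
        (\<Sum>X\<in>{X \<in> Pow {..<m}. S \<subseteq> X}. \<phi> 1)"
      by (rule sum.inter_filter[symmetric]) simp
    ultimately show ?thesis by simp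
  qed
  also have "{X. S \<subseteq> X \<and> X \<subseteq> {..<m}} = (\<lambda>U. S \<union> U) ` Pow ({..<m} - S)"
  proof (intro equalityI subsetI)
    fix X assume "X \<in> {X. S \<subseteq> X \<and> X \<subseteq> {..<m}}"
    then show "X \<in> (\<lambda>U. S \<union> U) ` Pow ({..<m} - S)" by (intro image_eqI[of _ _ "X - S"]) auto
  qed (use S in auto)
  also have "card \<dots> = 2 ^ (m - r)"
    using S finS by (subst card_image) (auto simp: inj_on_def card_Pow card_Diff_subset)
  finally have "conv (wt (word_diff (2 ^ m) h ?b ?c)) = conv d" by (simp only: d of_nat_power of_nat_numeral)
  then have eq: "wt (word_diff (2 ^ m) h ?b ?c) = d" unfolding conv_eq .
  have "?s \<noteq> ?o"
  proof
    assume "?s = ?o"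
    from assoc_word_eqD[OF this point_in_cube[of m S]] have "int (\<Prod>\<alpha>\<in>S. point m S \<alpha>) = 0" .
    then show False unfolding prod_point[OF S(1)] by simp
  qed
  then have "?b \<noteq> ?c" using inj_on_eq_iff[OF inj_word_add[OF \<A>_subset_words] mem mem0] by simp
  moreover have "?b \<in> C" "?c \<in> C" unfolding a by (rule imageI[OF mem], rule imageI[OF mem0])
  ultimately show "\<exists>b\<in>C. \<exists>c\<in>C. b \<noteq> c \<and> wt (word_diff (2 ^ m) h b c) = d"
    using eq by (intro bexI[of _ ?b] bexI[of _ ?c]) auto
qed

section \<open>Power control\<close>

text \<open>The generating function of the quadratic form of a path. Negating the last weight gives the
  generating function of its Golay partner.\<close>

definition path_sum :: "nat \<Rightarrow> (nat \<Rightarrow> complex) \<Rightarrow> complex" where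
  "path_sum n w = (\<Sum>y\<in>cube n. (-1) ^ (\<Sum>i<n - 1. y i * y (i + 1)) * (\<Prod>i<n. w i ^ y i))"

lemma sum_cube_Suc: "(\<Sum>x\<in>cube (Suc n). f x) = (\<Sum>y\<in>cube n. f (y(n := 0)) + f (y(n := 1)))"
proof -
  have "cube (Suc n) = (\<lambda>(b, y). y(n := b)) ` ({0, 1} \<times> cube n)"
    by (simp add: cube_def lessThan_Suc PiE_insert_eq)
  moreover have "inj_on (\<lambda>(b, y). y(n := b)) ({0, 1} \<times> cube n)"
    unfolding cube_def by (rule inj_combinator) simp
  ultimately have "bij_betw (\<lambda>(b, y). y(n := b)) ({0, 1} \<times> cube n) (cube (Suc n))"
    unfolding bij_betw_def by simp
  from sum.reindex_bij_betw[OF this, of f]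
  have "(\<Sum>x\<in>cube (Suc n). f x) = (\<Sum>(b, y)\<in>{0, 1} \<times> cube n. f (y(n := b)))"
    by (simp only: case_prod_unfold)
  also have "\<dots> = (\<Sum>b\<in>{0, 1}. \<Sum>y\<in>cube n. f (y(n := b)))"
    by (rule sum.cartesian_product[symmetric])
  finally show ?thesis by (simp add: sum.distrib)
qed

lemma path_sum_cong: "(\<And>i. i < n \<Longrightarrow> v i = w i) \<Longrightarrow> path_sum n v = path_sum n w"
  unfolding path_sum_def by (intro sum.cong refl arg_cong2[where f = "(*)"] prod.cong) auto

text \<open>Splitting on the last variable: value 0 leaves the shorter sum, value 1 contributes
  \<open>w n\<close> and the sign of the new edge, which is absorbed by negating the weight at
  \<open>n - 1\<close>.\<close>

lemma path_sum_Suc: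
  "path_sum (Suc n) w = path_sum n w + w n * path_sum n (w(n - 1 := - w (n - 1)))"
proof -
  define s where "s y = (-1) ^ (\<Sum>i<n - 1. y i * y (i + 1)) * (\<Prod>i<n. w i ^ y i)"
    for y :: "nat \<Rightarrow> nat"
  let ?w = "w(n - 1 := - w (n - 1))"
  have zero: "(-1) ^ (\<Sum>i<n. (y(n := 0)) i * (y(n := 0)) (i + 1)) * (\<Prod>i<Suc n. w i ^ (y(n := 0)) i) = s y"
    for y
  proof -
    have "(\<Sum>i<n. (y(n := 0)) i * (y(n := 0)) (i + 1)) = (\<Sum>i<n - 1. y i * y (i + 1))"
      by (cases n) (auto intro!: sum.cong)
    then show ?thesis by (simp add: s_def)
  qed
  \<comment> \<open>For \<open>n = 0\<close> there is no edge, and the modified weight does not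
    enter the empty product.\<close>
  have one: "(-1) ^ (\<Sum>i<n. (y(n := 1)) i * (y(n := 1)) (i + 1)) * (\<Prod>i<Suc n. w i ^ (y(n := 1)) i) =
      w n * ((-1) ^ (\<Sum>i<n - 1. y i * y (i + 1)) * (\<Prod>i<n. ?w i ^ y i))" for y
  proof (cases n)
    case (Suc l)
    have exponent: "(\<Sum>i<n. (y(n := 1)) i * (y(n := 1)) (i + 1)) = (\<Sum>i<n - 1. y i * y (i + 1)) + y l"
      unfolding Suc sum.lessThan_Suc diff_Suc_1 by (intro arg_cong2[where f = "(+)"] sum.cong) auto
    have "(\<Prod>i<l. ?w i ^ y i) = (\<Prod>i<l. w i ^ y i)" using Suc by (intro prod.cong) auto
    moreover have "?w l = - w l" using Suc by simp
    moreover have "(- w l) ^ y l = (-1) ^ y l * w l ^ y l" by (rule power_minus)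
    ultimately have sign: "(\<Prod>i<n. ?w i ^ y i) = (-1) ^ y l * (\<Prod>i<n. w i ^ y i)"
      unfolding Suc prod.lessThan_Suc by (simp only: mult_ac)
    have last: "(\<Prod>i<Suc n. w i ^ (y(n := 1)) i) = (\<Prod>i<n. w i ^ y i) * w n" by simp
    show ?thesis unfolding exponent sign last by (simp only: power_add mult_ac)
  qed simp
  show ?thesis
    unfolding path_sum_def[of "Suc n"] sum_cube_Suc diff_Suc_1 zero one
    by (simp add: path_sum_def s_def sum.distrib sum_distrib_left)
qed

lemma parallelogram: "(cmod (a + b))\<^sup>2 + (cmod (a - b))\<^sup>2 = 2 * ((cmod a)\<^sup>2 + (cmod b)\<^sup>2)"
  unfolding cmod_power2 by (simp add: power2_eq_square algebra_simps)

text \<open>The two longer sums are \<open>a + b\<close> and \<open>a - b\<close>, where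
  \<open>a\<close> is the shorter sum and \<open>b\<close> is the unimodular \<open>w n\<close>
  times its partner, so the parallelogram identity doubles the constant. The base is
  \<open>1 + 1 = 2\<close>.\<close>

lemma path_sum_golay:
  assumes "\<And>i. i < n \<Longrightarrow> cmod (w i) = 1"
  shows "(cmod (path_sum n w))\<^sup>2 + (cmod (path_sum n (w(n - 1 := - w (n - 1)))))\<^sup>2 = 2 ^ (n + 1)"
  using assms
proof (induction n)
  case 0
  have "path_sum 0 v = 1" for v by (simp add: path_sum_def cube_def)
  then show ?case by simp
next
  case (Suc n)
  let ?w = "w(n - 1 := - w (n - 1))"
  have "path_sum (Suc n) (w(n := - w n)) = path_sum n w - w n * path_sum n ?w"
  proof -
    have "path_sum n ((w(n := - w n))(n - 1 := - (w(n := - w n)) (n - 1))) = path_sum n ?w"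
      by (rule path_sum_cong) auto
    moreover have "path_sum n (w(n := - w n)) = path_sum n w" by (rule path_sum_cong) auto
    ultimately show ?thesis unfolding path_sum_Suc by simp
  qed
  then have "(cmod (path_sum (Suc n) w))\<^sup>2 + (cmod (path_sum (Suc n) (w(n := - w n))))\<^sup>2 =
      2 * ((cmod (path_sum n w))\<^sup>2 + (cmod (w n * path_sum n ?w))\<^sup>2)"
    by (simp only: path_sum_Suc[of n w] parallelogram)
  moreover have "cmod (w n * path_sum n ?w) = cmod (path_sum n ?w)"
    using Suc.prems[of n] by (simp add: norm_mult)
  moreover have "(cmod (path_sum n w))\<^sup>2 + (cmod (path_sum n ?w))\<^sup>2 = 2 ^ (n + 1)"
    using Suc.prems by (intro Suc.IH) simp
  ultimately show ?case unfolding diff_Suc_1 by (simp only: power_Suc add_Suc)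
qed

text \<open>Renaming coordinates along \<open>\<pi>\<close> straightens the path at the cost of
  permuting the weights, which stay arbitrary in the Golay bound.\<close>

lemma path_sum_permuted:
  assumes "\<pi> permutes {..<n}"
  shows "(\<Sum>y\<in>cube n. (-1) ^ (\<Sum>i<n - 1. y (\<pi> i) * y (\<pi> (i + 1))) * (\<Prod>i<n. w i ^ y i)) =
    path_sum n (w \<circ> \<pi>)"
proof -
  have lt: "\<pi> i < n \<longleftrightarrow> i < n" for i using permutes_in_image[OF assms, of i] by simp
  define \<phi> where "\<phi> = (\<lambda>y. \<lambda>i\<in>{..<n}. y (\<pi> i) :: nat)"
  have bij: "bij_betw \<phi> (cube n) (cube n)"
    unfolding \<phi>_def
  proof (rule bij_betw_byWitness[where f' = "\<lambda>y. \<lambda>i\<in>{..<n}. y (inv \<pi> i)"])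
    have lt': "inv \<pi> i < n \<longleftrightarrow> i < n" for i
      using permutes_in_image[OF permutes_inv[OF assms], of i] by simp
    show "\<forall>y\<in>cube n. (\<lambda>i\<in>{..<n}. (\<lambda>i\<in>{..<n}. y (\<pi> i)) (inv \<pi> i)) = y"
    proof (intro ballI ext)
      fix y i assume "y \<in> cube n"
      then show "(\<lambda>i\<in>{..<n}. (\<lambda>i\<in>{..<n}. y (\<pi> i)) (inv \<pi> i)) i = y i"
        using lt' permutes_inverses(1)[OF assms]
        by (cases "i < n") (auto simp: cube_def PiE_def extensional_def)
    qed
    show "\<forall>y\<in>cube n. (\<lambda>i\<in>{..<n}. (\<lambda>i\<in>{..<n}. y (inv \<pi> i)) (\<pi> i)) = y"
    proof (intro ballI ext)
      fix y i assume "y \<in> cube n"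
      then show "(\<lambda>i\<in>{..<n}. (\<lambda>i\<in>{..<n}. y (inv \<pi> i)) (\<pi> i)) i = y i"
        using lt permutes_inverses(2)[OF assms]
        by (cases "i < n") (auto simp: cube_def PiE_def extensional_def)
    qed
    have mem: "(\<lambda>i\<in>{..<n}. y (\<sigma> i)) \<in> cube n" if "y \<in> cube n" "\<And>i. \<sigma> i < n \<longleftrightarrow> i < n" for y \<sigma>
      unfolding cube_def restrict_PiE_iff
    proof
      fix i assume "i \<in> {..<n}"
      then show "y (\<sigma> i) \<in> {0, 1}" using PiE_mem[OF that(1)[unfolded cube_def], of "\<sigma> i"] that(2) by simp
    qed
    show "(\<lambda>y. \<lambda>i\<in>{..<n}. y (\<pi> i)) ` cube n \<subseteq> cube n" by (intro image_subsetI mem lt)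
    show "(\<lambda>y. \<lambda>i\<in>{..<n}. y (inv \<pi> i)) ` cube n \<subseteq> cube n" by (intro image_subsetI mem lt')
  qed
  have "(\<Prod>i<n. w i ^ y i) = (\<Prod>i<n. w (\<pi> i) ^ y (\<pi> i))" for y
    by (rule prod.reindex_bij_betw[OF permutes_imp_bij[OF assms], symmetric])
  then have weights: "(\<Prod>i<n. (w \<circ> \<pi>) i ^ \<phi> y i) = (\<Prod>i<n. w i ^ y i)" for y
    by (simp add: \<phi>_def)
  have exponent: "(\<Sum>i<n - 1. \<phi> y i * \<phi> y (i + 1)) = (\<Sum>i<n - 1. y (\<pi> i) * y (\<pi> (i + 1)))" for y
    by (intro sum.cong) (auto simp: \<phi>_def)
  have "path_sum n (w \<circ> \<pi>) = (\<Sum>y\<in>cube n.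
      (-1) ^ (\<Sum>i<n - 1. \<phi> y i * \<phi> y (i + 1)) * (\<Prod>i<n. (w \<circ> \<pi>) i ^ \<phi> y i))"
    unfolding path_sum_def by (rule sum.reindex_bij_betw[OF bij, symmetric])
  then show ?thesis unfolding weights exponent by (rule sym)
qed

lemma cmod_path_sum_le:
  assumes "\<And>i. i < n \<Longrightarrow> cmod (w i) = 1"
  shows "cmod (path_sum n w) \<le> sqrt (2 ^ (n + 1))"
proof (rule real_le_rsqrt)
  have "(cmod (path_sum n w))\<^sup>2 + (cmod (path_sum n (w(n - 1 := - w (n - 1)))))\<^sup>2 = 2 ^ (n + 1)"
    using assms by (rule path_sum_golay)
  moreover have "0 \<le> (cmod (path_sum n (w(n - 1 := - w (n - 1)))))\<^sup>2" by simp
  ultimately show "(cmod (path_sum n w))\<^sup>2 \<le> 2 ^ (n + 1)" by linarith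
qed

text \<open>Each of the \<open>2 ^ k\<close> inner sums is at most
  \<open>sqrt (2 ^ (n + 1))\<close>. The squared total \<open>2 ^ (2 * k + n + 1)\<close> is the
  length \<open>2 ^ (n + k)\<close> times \<open>2 ^ (k + 1)\<close>.\<close>

lemma cmod_sum_cube_le:
  fixes \<pi> :: "(nat \<Rightarrow> nat) \<Rightarrow> nat \<Rightarrow> nat" and w :: "(nat \<Rightarrow> nat) \<Rightarrow> nat \<Rightarrow> complex"
  assumes "\<And>d. d \<in> cube k \<Longrightarrow> \<pi> d permutes {..<n}"
    and "\<And>d i. d \<in> cube k \<Longrightarrow> i < n \<Longrightarrow> cmod (w d i) = 1"
    and "\<And>d. d \<in> cube k \<Longrightarrow> cmod (K d) = 1"
    and \<Phi>: "\<And>d y. d \<in> cube k \<Longrightarrow> y \<in> cube n \<Longrightarrow> \<Phi> (join_coords n k y d) =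
      K d * ((-1) ^ (\<Sum>i<n - 1. y (\<pi> d i) * y (\<pi> d (i + 1))) * (\<Prod>i<n. w d i ^ y i))"
  shows "(cmod (\<Sum>x\<in>cube (n + k). \<Phi> x))\<^sup>2 \<le> 2 ^ (n + k) * 2 ^ (k + 1)"
proof -
  have "cmod (\<Sum>x\<in>cube (n + k). \<Phi> x) \<le> (\<Sum>d\<in>cube k. cmod (\<Sum>y\<in>cube n. \<Phi> (join_coords n k y d)))"
    unfolding sum_cube_join_coords by (rule norm_sum)
  also have "\<dots> \<le> (\<Sum>d\<in>cube k. sqrt (2 ^ (n + 1)))"
  proof (rule sum_mono)
    fix d assume d: "d \<in> cube k"
    have "(\<Sum>y\<in>cube n. \<Phi> (join_coords n k y d)) = K d * path_sum n (w d \<circ> \<pi> d)"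
      unfolding path_sum_permuted[OF assms(1)[OF d], symmetric] sum_distrib_left
      by (intro sum.cong refl \<Phi> d)
    moreover have "cmod (path_sum n (w d \<circ> \<pi> d)) \<le> sqrt (2 ^ (n + 1))"
      using permutes_in_image[OF assms(1)[OF d]] assms(2)[OF d] by (intro cmod_path_sum_le) auto
    ultimately show "cmod (\<Sum>y\<in>cube n. \<Phi> (join_coords n k y d)) \<le> sqrt (2 ^ (n + 1))"
      by (simp add: norm_mult assms(3)[OF d])
  qed
  also have "\<dots> = 2 ^ k * sqrt (2 ^ (n + 1))" by (simp add: card_cube)
  finally have "(cmod (\<Sum>x\<in>cube (n + k). \<Phi> x))\<^sup>2 \<le> (2 ^ k * sqrt (2 ^ (n + 1)))\<^sup>2"
    by (intro power_mono) auto
  also have "\<dots> = 2 ^ (n + k) * 2 ^ (k + 1)"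
    by (simp add: power_mult_distrib power2_eq_square power_add mult_ac)
  finally show ?thesis .
qed

section \<open>Roots of unity, factoring of the transform and the PMEPR bound\<close>

lemma root_of_unity_powi_cong:
  assumes "a mod 2 ^ h = b mod 2 ^ h"
  shows "root_of_unity h powi a = root_of_unity h powi b"
proof -
  obtain q where "a - b = 2 ^ h * q" using assms unfolding mod_eq_dvd_iff by (rule dvdE)
  then have "a = b + 2 ^ h * q" by simp
  then have "2 * pi * real_of_int a / 2 ^ h = 2 * pi * real_of_int b / 2 ^ h + 2 * pi * real_of_int q"
    by (simp add: field_simps)
  then show ?thesis
    unfolding root_of_unity_powi by (simp add: cis_mult[symmetric] cis_multiple_2pi)
qed

lemma root_of_unity_nz: "root_of_unity h \<noteq> 0" by (simp add: root_of_unity_def)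

lemma root_of_unity_powi_add:
  "root_of_unity h powi (a + b) = root_of_unity h powi a * root_of_unity h powi b"
  by (simp add: power_int_add root_of_unity_nz)

lemma root_of_unity_powi_sum:
  "root_of_unity h powi (\<Sum>i\<in>I. f i) = (\<Prod>i\<in>I. root_of_unity h powi f i)"
  by (induction I rule: infinite_finite_induct) (auto simp: root_of_unity_powi_add)

lemma root_of_unity_powi_mult_nat:
  "root_of_unity h powi (int n * a) = (root_of_unity h powi a) ^ n"
  by (simp add: power_int_mult mult.commute[of "int n"])

lemma root_of_unity_half:
  assumes "h \<ge> 1" shows "root_of_unity h powi (2 ^ (h - 1)) = -1"
proof -
  have "(2::real) ^ h = 2 * 2 ^ (h - 1)" using assms by (cases h) auto
  then show ?thesis unfolding root_of_unity_powi by simp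
qed

lemma cmod_root_of_unity_powi [simp]: "cmod (root_of_unity h powi a) = 1"
  by (simp add: root_of_unity_powi)

lemma PMEPR_le:
  assumes "n > 0" "\<And>\<theta>. (cmod (\<Sum>i<n. C i * exp (2 * of_real pi * \<i> * of_real ((real i + \<zeta>) * \<theta>))))\<^sup>2 \<le> real n * B"
  shows "PMEPR \<zeta> n C \<le> B"
proof -
  have "(SUP \<theta>\<in>{0..<1}.
      (cmod (\<Sum>i<n. C i * exp (2 * of_real pi * \<i> * of_real ((real i + \<zeta>) * \<theta>))))\<^sup>2) \<le> real n * B"
    by (intro cSUP_least assms(2)) simp
  then show ?thesis unfolding PMEPR_def using assms(1) by (simp add: field_simps)
qed

text \<open>The selector in the definition of \<open>\<R>\<close>: each factor is 1 if the bits
  agree and 0 otherwise, relying on \<open>0 ^ 0 = 1\<close>.\<close>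

lemma prod_power_indicator:
  assumes "d \<in> cube k" "\<And>j. j < k \<Longrightarrow> e j \<in> {0, 1}"
  shows "(\<Prod>j<k. e j ^ d j * (1 - e j) ^ (1 - d j)) = (if \<forall>j<k. e j = d j then 1 else (0::nat))"
proof -
  have "e j ^ d j * (1 - e j) ^ (1 - d j) = (if e j = d j then 1 else 0)" if "j < k" for j
  proof -
    have "d j \<in> {0, 1}" using assms(1) that by (auto simp: cube_def PiE_def Pi_def)
    then show ?thesis using assms(2)[OF that] by auto
  qed
  then have "(\<Prod>j<k. e j ^ d j * (1 - e j) ^ (1 - d j)) = (\<Prod>j<k. if e j = d j then 1 else 0)"
    by (intro prod.cong) auto
  also have "\<dots> = (if \<forall>j<k. e j = d j then 1 else 0)"
  proof (cases "\<forall>j<k. e j = d j")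
    case False
    then show ?thesis by (auto intro!: prod_zero)
  qed simp
  finally show ?thesis .
qed

text \<open>With the last coordinates fixed to \<open>d\<close>, the selectors kill every summand
  but the one at \<open>d\<close>, leaving the quadratic form of one path.\<close>

lemma \<R>_function_join_coords:
  assumes d: "d \<in> cube k" and y: "y \<in> cube n"
    and \<pi>: "\<And>d. d \<in> cube k \<Longrightarrow> \<pi> d permutes {..<n}"
  defines "x \<equiv> join_coords n k y d"
  shows "(\<Sum>d\<in>cube k. \<Sum>i<n - 1. int (x (\<pi> d i) * x (\<pi> d (i + 1)) *
      (\<Prod>j<k. x (n + j) ^ d j * (1 - x (n + j)) ^ (1 - d j)))) =
    int (\<Sum>i<n - 1. y (\<pi> d i) * y (\<pi> d (i + 1)))" (is "(\<Sum>d\<in>_. ?f d) = _")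
proof -
  have xd: "x (n + j) = d j" if "j < k" for j using that by (simp add: x_def join_coords_def)
  have prod: "(\<Prod>j<k. x (n + j) ^ d' j * (1 - x (n + j)) ^ (1 - d' j)) = (if d' = d then 1 else 0)"
    if d': "d' \<in> cube k" for d'
  proof -
    have "x (n + j) \<in> {0, 1}" if "j < k" for j
      using PiE_mem[OF d[unfolded cube_def], of j] that by (simp add: xd)
    then have "(\<Prod>j<k. x (n + j) ^ d' j * (1 - x (n + j)) ^ (1 - d' j)) =
        (if \<forall>j<k. x (n + j) = d' j then 1 else 0)"
      by (intro prod_power_indicator[OF d'])
    moreover have "(\<forall>j<k. x (n + j) = d' j) \<longleftrightarrow> d' = d"
    proof
      assume "\<forall>j<k. x (n + j) = d' j"
      then show "d' = d" by (intro PiE_ext[OF d'[unfolded cube_def] d[unfolded cube_def]]) (auto simp: xd)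
    qed (simp add: xd)
    ultimately show ?thesis by simp
  qed
  have xy: "x (\<pi> d i) = y (\<pi> d i)" if "i < n" for i
    using permutes_in_image[OF \<pi>[OF d], of i] that by (simp add: x_def join_coords_first)
  have "(\<Sum>d\<in>cube k. ?f d) = (\<Sum>d'\<in>cube k. if d' = d then ?f d else 0)"
  proof (intro sum.cong refl)
    fix d' assume d': "d' \<in> cube k"
    show "?f d' = (if d' = d then ?f d else 0)"
      unfolding prod[OF d'] prod[OF d] by (cases "d' = d") simp_all
  qed
  also have "\<dots> = ?f d" using d by simp
  also have "\<dots> = (\<Sum>i<n - 1. int (y (\<pi> d i) * y (\<pi> d (i + 1))))"
    unfolding prod[OF d] by (intro sum.cong refl) (simp add: xy)
  finally show ?thesis by (simp only: of_nat_sum)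
qed

text \<open>Since \<open>i\<close> is the sum of its digits times powers of two, the exponential
  factors over the coordinates; the shift \<open>\<zeta>\<close> yields one unimodular
  constant.\<close>

lemma exp_digits:
  assumes "i < 2 ^ m"
  shows "exp (2 * of_real pi * \<i> * of_real ((real i + \<zeta>) * \<theta>)) =
    cis (2 * pi * \<zeta> * \<theta>) * (\<Prod>\<alpha><m. cis (2 * pi * \<theta> * 2 ^ \<alpha>) ^ binary_digits m i \<alpha>)"
proof -
  have cis_sum: "cis (\<Sum>\<alpha>\<in>I. t \<alpha>) = (\<Prod>\<alpha>\<in>I. cis (t \<alpha>))" for t and I :: "nat set"
    by (induction I rule: infinite_finite_induct) (simp_all add: cis_mult[symmetric])
  have "real i = real (\<Sum>\<alpha><m. i div 2 ^ \<alpha> mod 2 * 2 ^ \<alpha>)" using sum_binary_digits[OF assms] by simp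
  also have "\<dots> = (\<Sum>\<alpha><m. real (binary_digits m i \<alpha>) * 2 ^ \<alpha>)"
    unfolding of_nat_sum by (simp add: binary_digits_def)
  finally have digits: "2 * pi * \<theta> * real i = (\<Sum>\<alpha><m. real (binary_digits m i \<alpha>) * (2 * pi * \<theta> * 2 ^ \<alpha>))"
    by (simp add: sum_distrib_left mult_ac)
  have "exp (2 * of_real pi * \<i> * of_real ((real i + \<zeta>) * \<theta>)) =
      cis (2 * pi * \<zeta> * \<theta> + 2 * pi * \<theta> * real i)"
    by (simp add: cis_conv_exp algebra_simps)
  then show ?thesis unfolding digits cis_mult[symmetric] cis_sum Complex.DeMoivre .
qed

text \<open>A word of the coset is the given word \<open>w\<close> plus a difference of two
  codewords. Code functions are linear in their data, so this difference is a code function with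
  integer-valued parts.\<close>

lemma coset_word_function:
  assumes "is_coset (2 ^ m) h (\<A> k r m h) C" "c \<in> C" "w \<in> C"
    and w: "w = assoc_word m (\<lambda>x. F x mod 2 ^ h)"
  obtains us u where "\<And>i. i < 2 ^ m \<Longrightarrow>
    c i mod 2 ^ h = (F (binary_digits m i) + code_function k m us u (binary_digits m i)) mod 2 ^ h"
proof -
  obtain a where a: "C = word_add (2 ^ m) h a ` \<A> k r m h" using assms(1) by (auto simp: is_coset_def)
  obtain c1 c2 where c1: "c1 \<in> \<A> k r m h" "c = word_add (2 ^ m) h a c1"
    and c2: "c2 \<in> \<A> k r m h" "w = word_add (2 ^ m) h a c2"
    using assms(2,3) unfolding a by auto
  obtain us1 u1 where 1: "c1 = assoc_word m (\<lambda>x. code_function k m us1 u1 x mod 2 ^ h)"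
    using c1 by (auto simp: \<A>_eq)
  obtain us2 u2 where 2: "c2 = assoc_word m (\<lambda>x. code_function k m us2 u2 x mod 2 ^ h)"
    using c2 by (auto simp: \<A>_eq)
  show thesis
  proof (rule that[of "\<lambda>i d. us1 i d - us2 i d" "\<lambda>d. u1 d - u2 d"])
    fix i assume i: "i < (2::nat) ^ m"
    let ?x = "binary_digits m i"
    have "c i mod 2 ^ h = (a i + code_function k m us1 u1 ?x) mod 2 ^ h"
      using i by (simp add: c1(2) 1 word_add_def assoc_word_def mod_add_right_eq)
    moreover have "F ?x mod 2 ^ h = (a i + code_function k m us2 u2 ?x) mod 2 ^ h"
      using i fun_cong[OF c2(2), of i] by (simp add: w 2 word_add_def assoc_word_def mod_add_right_eq)
    ultimately have "2 ^ h dvd c i - (a i + code_function k m us1 u1 ?x) -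
        (F ?x - (a i + code_function k m us2 u2 ?x))"
      by (simp only: mod_eq_dvd_iff dvd_diff)
    moreover have "code_function k m (\<lambda>i d. us1 i d - us2 i d) (\<lambda>d. u1 d - u2 d) ?x =
        code_function k m us1 u1 ?x - code_function k m us2 u2 ?x"
      by (simp add: code_function_def right_diff_distrib sum_subtractf)
    moreover have "c i - (a i + A) - (F ?x - (a i + B)) = c i - (F ?x + (A - B))" for A B by simp
    ultimately show "c i mod 2 ^ h = (F ?x + code_function k m (\<lambda>i d. us1 i d - us2 i d)
        (\<lambda>d. u1 d - u2 d) ?x) mod 2 ^ h"
      unfolding mod_eq_dvd_iff by (simp only:)
  qed
qed

text \<open>For fixed last coordinates a word of the coset is a path form scaled by
  \<open>2 ^ (h - 1)\<close> plus an affine function of the free coordinates. Affine terms only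
  alter unimodular weights, for which the Golay bound is uniform.\<close>

lemma coset_PMEPR_le:
  assumes k: "k < m" and h: "h \<ge> 1" and coset: "is_coset (2 ^ m) h (\<A> k r m h) C"
    and R: "C \<inter> \<R> k m h \<noteq> {}" and c: "c \<in> C"
  shows "PMEPR \<zeta> (2 ^ m) (polyphase h c) \<le> 2 ^ (k + 1)"
proof (rule PMEPR_le)
  fix \<theta> :: real
  define n where "n = m - k"
  have m: "m = n + k" and mk: "m - k = n" using k by (simp_all add: n_def)
  obtain w where "w \<in> C" "w \<in> \<R> k m h" using R by auto
  then obtain \<pi> where \<pi>: "\<And>d. d \<in> cube k \<Longrightarrow> \<pi> d permutes {..<n}"
    and w: "w = assoc_word m (\<lambda>x. (2 ^ (h - 1) *
         (\<Sum>d\<in>cube k. \<Sum>i<n - 1.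
            int (x (\<pi> d i) * x (\<pi> d (i + 1)) *
              (\<Prod>j<k. x (n + j) ^ d j * (1 - x (n + j)) ^ (1 - d j))))) mod 2 ^ h)"
    unfolding \<R>_def mk by blast
  define F where "F x = 2 ^ (h - 1) * (\<Sum>d\<in>cube k. \<Sum>i<n - 1.
            int (x (\<pi> d i) * x (\<pi> d (i + 1)) *
              (\<Prod>j<k. x (n + j) ^ d j * (1 - x (n + j)) ^ (1 - d j))))" for x :: "nat \<Rightarrow> nat"
  obtain us u where u: "\<And>i. i < 2 ^ m \<Longrightarrow>
    c i mod 2 ^ h = (F (binary_digits m i) + code_function k m us u (binary_digits m i)) mod 2 ^ h"
    using coset_word_function[OF coset c \<open>w \<in> C\<close>, of F] w unfolding F_def by blast
  let ?e = "\<lambda>\<alpha>. cis (2 * pi * \<theta> * 2 ^ \<alpha>)"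
  define \<Phi> where "\<Phi> x = root_of_unity h powi (F x + code_function k m us u x) *
      (cis (2 * pi * \<zeta> * \<theta>) * (\<Prod>\<alpha><m. ?e \<alpha> ^ x \<alpha>))" for x
  \<comment> \<open>\<open>W d i\<close> is the factor contributed by free coordinate
    \<open>i\<close> when it is 1; everything that depends only on \<open>d\<close> is collected in
    \<open>K d\<close>.\<close>
  define W where "W d i = root_of_unity h powi us i d * ?e i" for d i
  define K where "K d = root_of_unity h powi u d * cis (2 * pi * \<zeta> * \<theta>) *
      (\<Prod>j<k. ?e (n + j) ^ d j)" for d :: "nat \<Rightarrow> nat"
  have "(\<Sum>i<2 ^ m. polyphase h c i * exp (2 * of_real pi * \<i> * of_real ((real i + \<zeta>) * \<theta>))) =
      (\<Sum>i<2 ^ m. \<Phi> (binary_digits m i))"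
  proof (intro sum.cong refl)
    fix i :: nat assume "i \<in> {..<2 ^ m}"
    then have i: "i < 2 ^ m" by simp
    show "polyphase h c i * exp (2 * of_real pi * \<i> * of_real ((real i + \<zeta>) * \<theta>)) = \<Phi> (binary_digits m i)"
      unfolding polyphase_def \<Phi>_def exp_digits[OF i] root_of_unity_powi_cong[OF u[OF i]] ..
  qed
  also have "\<dots> = (\<Sum>x\<in>cube (n + k). \<Phi> x)" unfolding sum_word m ..
  finally have sum: "(\<Sum>i<2 ^ m. polyphase h c i *
      exp (2 * of_real pi * \<i> * of_real ((real i + \<zeta>) * \<theta>))) = (\<Sum>x\<in>cube (n + k). \<Phi> x)" .
  have "(cmod (\<Sum>x\<in>cube (n + k). \<Phi> x))\<^sup>2 \<le> 2 ^ (n + k) * 2 ^ (k + 1)"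
  proof (rule cmod_sum_cube_le[where K = K and w = W, OF \<pi>])
    show "cmod (W d i) = 1" for d i by (simp add: W_def norm_mult)
    show "cmod (K d) = 1" for d by (simp add: K_def norm_mult prod_norm[symmetric] norm_power)
    fix d y assume d: "d \<in> cube k" and y: "y \<in> cube n"
    let ?x = "join_coords n k y d" and ?N = "\<Sum>i<n - 1. y (\<pi> d i) * y (\<pi> d (i + 1))"
    \<comment> \<open>The root of unity raised to \<open>2 ^ (h - 1)\<close> is -1, so the quadratic
      form turns into the signs of \<open>path_sum\<close>.\<close>
    have "F ?x = int ?N * 2 ^ (h - 1)"
      unfolding F_def by (subst \<R>_function_join_coords[OF d y]) (simp_all only: \<pi> mult.commute)
    then have rF: "root_of_unity h powi F ?x = (-1) ^ ?N"
      by (simp only: root_of_unity_powi_mult_nat root_of_unity_half[OF h])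
    have "code_function k m us u ?x = (\<Sum>i<n. int (y i) * us i d) + u d"
      unfolding code_function_def mk by (simp add: m last_coords_join_coords d join_coords_first)
    then have rc: "root_of_unity h powi code_function k m us u ?x =
        (\<Prod>i<n. (root_of_unity h powi us i d) ^ y i) * root_of_unity h powi u d"
      by (simp only: root_of_unity_powi_add root_of_unity_powi_sum root_of_unity_powi_mult_nat)
    have "(\<Prod>\<alpha><m. ?e \<alpha> ^ ?x \<alpha>) = (\<Prod>\<alpha><n. ?e \<alpha> ^ y \<alpha>) * (\<Prod>j<k. ?e (n + j) ^ d j)"
    proof -
      have "{..<m} = {..<n} \<union> (+) n ` {..<k}"
        using image_add_atLeastLessThan[of n 0 k] unfolding m lessThan_atLeast0
        by (simp add: ivl_disj_un(17) add.commute)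
      then have "(\<Prod>\<alpha><m. ?e \<alpha> ^ ?x \<alpha>) = (\<Prod>\<alpha><n. ?e \<alpha> ^ ?x \<alpha>) * (\<Prod>\<alpha>\<in>(+) n ` {..<k}. ?e \<alpha> ^ ?x \<alpha>)"
        by (simp only:) (rule prod.union_disjoint, auto)
      also have "(\<Prod>\<alpha>\<in>(+) n ` {..<k}. ?e \<alpha> ^ ?x \<alpha>) = (\<Prod>j<k. ?e (n + j) ^ d j)"
        by (subst prod.reindex) (auto simp: join_coords_def)
      finally show ?thesis by (simp add: join_coords_first)
    qed
    then show "\<Phi> ?x = K d * ((-1) ^ ?N * (\<Prod>i<n. W d i ^ y i))"
      unfolding \<Phi>_def root_of_unity_powi_add rF rc K_def W_def
      by (simp add: power_mult_distrib prod.distrib)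
  qed
  then show "(cmod (\<Sum>i<2 ^ m. polyphase h c i *
      exp (2 * of_real pi * \<i> * of_real ((real i + \<zeta>) * \<theta>))))\<^sup>2 \<le> real (2 ^ m) * 2 ^ (k + 1)"
    unfolding sum by (simp add: m)
qed simp

theorem mainTheorem2:
  fixes k m r h :: nat and \<zeta> :: real and C :: "(nat \<Rightarrow> int) set"
  assumes "k < m" and "r \<le> k + 1" and "h \<ge> 1" and "\<zeta> > 0"
    and "is_coset (2 ^ m) h (\<A> k r m h) C"
    and "C \<inter> \<R> k m h \<noteq> {}"
  shows "(\<forall>c\<in>C. PMEPR \<zeta> (2 ^ m) (polyphase h c) \<le> 2 ^ (k + 1))
    \<and> minimum_distance (lee_distance (2 ^ m) h) C = 2 ^ (m - r)
    \<and> minimum_distance (sq_euclidean_distance (2 ^ m) h) C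
        = 2 ^ (m - r + 2) * (sin (pi / 2 ^ h))\<^sup>2
    \<and> log 2 (real (card C)) = log 2 (real (card (\<A> k r m h)))
    \<and> log 2 (real (card (\<A> k r m h)))
        = real (m - k) * log 2 (real (card (\<F> (int r - 1) k h)))
          + log 2 (real (card (\<F> (int r) k h)))
    \<and> (\<forall>\<rho>\<in>{int r - 1, int r}.
         log 2 (real (card (\<F> \<rho> k h)))
           = real ((\<Sum>i\<in>{0..\<rho>}. h * (k choose nat i))
                   + (\<Sum>i\<in>{1..int h - 1}. nat (int h - i) * (k choose nat (\<rho> + i)))))"
proof (intro conjI)
  show "\<forall>c\<in>C. PMEPR \<zeta> (2 ^ m) (polyphase h c) \<le> 2 ^ (k + 1)"
    using coset_PMEPR_le[OF assms(1,3,5,6)] by blast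
  \<comment> \<open>The entry 1 has Lee weight 1 also for \<open>h = 1\<close>, where both terms of
    the minimum are 1.\<close>
  have one: "min 1 (2 ^ h - 1) = (1::int)"
    using power_increasing[OF assms(3), of "2::int"] by simp
  have "minimum_distance (\<lambda>a b. lee_weight (2 ^ m) h (word_diff (2 ^ m) h a b)) C = 2 ^ (m - r)"
  proof (rule coset_minimum_distance[OF assms(1,2,3,5), where conv = real_of_int
        and \<phi> = "\<lambda>a. real_of_int (min a (2 ^ h - a))"])
    show "real_of_int (lee_weight (2 ^ m) h a) = (\<Sum>i<2 ^ m. real_of_int (min (a i) (2 ^ h - a i)))"
      for a unfolding lee_weight_def of_int_sum ..
    show "2 ^ j * real_of_int (min 1 (2 ^ h - 1)) \<le> real_of_int (min a (2 ^ h - a))"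
      if "j < h" "a \<in> Zpow2 h" "a \<noteq> 0" "2 ^ j dvd a" for a j
      using lee_ge[OF that] unfolding one by simp
    show "real_of_int (2 ^ (m - r)) = 2 ^ (m - r) * real_of_int (min 1 (2 ^ h - 1))"
      unfolding one by simp
  qed auto
  then show "minimum_distance (lee_distance (2 ^ m) h) C = 2 ^ (m - r)"
    unfolding lee_distance_def[abs_def] .
  have "minimum_distance (\<lambda>a b. sq_euclidean_weight (2 ^ m) h (word_diff (2 ^ m) h a b)) C =
      2 ^ (m - r + 2) * (sin (pi / 2 ^ h))\<^sup>2"
  proof (rule coset_minimum_distance[OF assms(1,2,3,5), where conv = "\<lambda>x. x"
        and \<phi> = "\<lambda>a. (cmod (root_of_unity h powi a - 1))\<^sup>2"])
    show "2 ^ j * (cmod (root_of_unity h powi 1 - 1))\<^sup>2 \<le> (cmod (root_of_unity h powi a - 1))\<^sup>2"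
      if "j < h" "a \<in> Zpow2 h" "a \<noteq> 0" "2 ^ j dvd a" for a j
      using sq_dist_root_of_unity_ge[OF that] sq_dist_root_of_unity[of h 1] by simp
    show "2 ^ (m - r + 2) * (sin (pi / 2 ^ h))\<^sup>2 =
        2 ^ (m - r) * (cmod (root_of_unity h powi 1 - 1))\<^sup>2"
      unfolding sq_dist_root_of_unity by (simp add: power_add)
  qed (auto simp: sq_euclidean_weight_def)
  then show "minimum_distance (sq_euclidean_distance (2 ^ m) h) C =
      2 ^ (m - r + 2) * (sin (pi / 2 ^ h))\<^sup>2"
    unfolding sq_euclidean_distance_def[abs_def] .
  show "log 2 (real (card C)) = log 2 (real (card (\<A> k r m h)))"
    unfolding coset_card[OF assms(5)] ..
  show "log 2 (real (card (\<A> k r m h))) = real (m - k) * log 2 (real (card (\<F> (int r - 1) k h)))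
      + log 2 (real (card (\<F> (int r) k h)))"
    using assms(1,3) by (intro log_card_\<A>) auto
  show "\<forall>\<rho>\<in>{int r - 1, int r}. log 2 (real (card (\<F> \<rho> k h))) =
      real ((\<Sum>i\<in>{0..\<rho>}. h * (k choose nat i))
        + (\<Sum>i\<in>{1..int h - 1}. nat (int h - i) * (k choose nat (\<rho> + i))))"
  proof
    fix \<rho> assume "\<rho> \<in> {int r - 1, int r}"
    \<comment> \<open>The extreme value -1 occurs for \<open>r = 0\<close>.\<close>
    then have "\<rho> \<ge> -1" by auto
    then show "log 2 (real (card (\<F> \<rho> k h))) =
      real ((\<Sum>i\<in>{0..\<rho>}. h * (k choose nat i))
        + (\<Sum>i\<in>{1..int h - 1}. nat (int h - i) * (k choose nat (\<rho> + i))))"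
      by (rule log_card_\<F>[OF assms(3)])
  qed
qed

end
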